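(* Let $k\ge 0$. For all $(m,n)\in T_k$: (1) if $n=f_{2k+2}-1$, then $H_{m,n}=(-1)^{\frac{f_{2k}-1}{2}}\cdot f_{2k}$; (2) if $n=f_{2k+1}$, then $H_{m,n}=(-1)^{\Phi_k(m+n)-\frac{f_{2k+1}}{2}-1}\cdot f_{2k}$; (3) if $f_{2k}<n<f_{2k+2}-1$, then: if $m+n=\gamma_i-f_{2k}+1$ or $m+n=\gamma_i$ for some $i\ge1$, we have \[H_{m,n}=(-1)^{(f_{2k+2}-1-n)k}(-1)^{\frac{(f_{2k+2}-1-n)(f_{2k+2}-2-n)}{2}}(-1)^{\frac{f_{2k}-1}{2}}\cdot f_{2k};\] otherwise $H_{m,n}=0$.
   Context: Let $\tau$ be the substitution on $\{0,1\}$ with $\tau(1)=101$, $\tau(0)=1$ (extended to words by concatenation), and let $\mathbf{s}=(s_j)_{j\ge 0}=\lim_{j\to\infty}\tau^j(1)$ be its fixed point beginning with $1$. For $m\ge 0$, $n\ge 1$, $H_{m,n}=\det(s_{m+i+j})_{0\le i,j\le n-1}$. Define $f_{2j}=|\tau^j(1)|$, $f_{2j+1}=|\tau^j(10)|$ ($|w|$ = length of $w$); equivalently $f_0=1$, $f_1=2$, $f_{2j+2}=f_{2j}+f_{2j+1}$, $f_{2j+3}=f_{2j}+f_{2j+2}$; the $f_{2j+1}$ are even and the $f_{2j}$ odd. Every integer $n\ge0$ has a unique representation $n=\sum_{i\ge0}a_i(n)f_i$ with $a_i(n)\in\{0,1\}$, finitely many nonzero, $a_ia_{i+1}=0$ for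 all $i$, and $a_ia_{i+2}=0$ for all even $i$. For $k\ge0$ put $\Phi_k(n)=\sum_{i=0}^{2k+2}a_i(n)f_i$. Let $\mathbb{N}=\{0,1,2,\dots\}$. For $k\ge0$ let $E'_k=\{x\in\mathbb{N}:\Phi_k(x)=f_{2k+3}/2\}$ and let $(\gamma_i)_{i\ge1}$ be its increasing enumeration. For $i\ge1$ let $T_{k,i}=\{(m,n)\in\mathbb{N}^2: f_{2k+1}\le n<f_{2k+2},\ \gamma_i-f_{2k}<n+m\le\gamma_i\}$ and $T_k=\bigcup_{i\ge1}T_{k,i}$.
   Formalization: In part (3) the range f_{2k}<n<f_{2k+2}-1 is corrected to f_{2k+1}<n<f_{2k+2}-1; the literal range includes n=f_{2k+1}, where (3) contradicts (2), e.g. k=1, (m,n)=(0,4): H_{0,4}=-3, not 0. *)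

theory Defs
  imports "Jordan_Normal_Form.Determinant" "HOL-Library.Infinite_Set"
begin

text \<open>The alphabet is \<^typ>\<open>bool\<close>, with True for the letter 1 and False for the letter 0.\<close>

fun tau :: "bool \<Rightarrow> bool list" where
  "tau True = [True, False, True]"
| "tau False = [True]"

definition tau_word :: "bool list \<Rightarrow> bool list" where
  "tau_word w = concat (map tau w)"

definition tau_iter :: "nat \<Rightarrow> bool list \<Rightarrow> bool list" where
  "tau_iter j = tau_word ^^ j"

definition flen :: "nat \<Rightarrow> nat" where
  "flen i = length (tau_iter (i div 2) (if even i then [True] else [True, False]))"

text \<open>The words \<open>tau_iter j [True]\<close> are prefixes of one another, and the \<open>j\<close>-th one is longer
  than \<open>j\<close>. Hence the letter below is the stable value at position \<open>j\<close>; this is the content of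
  \<open>tau_iter_nth\<close> below.\<close>

definition s :: "nat \<Rightarrow> bool" where
  "s j = tau_iter j [True] ! j"

definition hankel :: "nat \<Rightarrow> nat \<Rightarrow> int" where
  "hankel m n = det (mat n n (\<lambda>(i, j). of_bool (s (m + i + j))))"

definition admissible :: "(nat \<Rightarrow> nat) \<Rightarrow> bool" where
  "admissible a \<longleftrightarrow> range a \<subseteq> {0, 1} \<and> finite {i. a i \<noteq> 0} \<and>
     (\<forall>i. a i * a (i + 1) = 0) \<and> (\<forall>i. even i \<longrightarrow> a i * a (i + 2) = 0)"

definition digits :: "nat \<Rightarrow> nat \<Rightarrow> nat" where
  "digits n = (THE a. admissible a \<and> n = (\<Sum>i | a i \<noteq> 0. a i * flen i))"

definition Phi :: "nat \<Rightarrow> nat \<Rightarrow> nat" where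
  "Phi k n = (\<Sum>i\<le>2*k+2. digits n i * flen i)"

definition E' :: "nat \<Rightarrow> nat set" where
  "E' k = {x. Phi k x = flen (2*k+3) div 2}"

text \<open>The library enumeration starts at index 0, whereas \<open>gamma k\<close> is used for indices \<open>i \<ge> 1\<close>.\<close>

definition gamma :: "nat \<Rightarrow> nat \<Rightarrow> nat" where
  "gamma k i = Infinite_Set.enumerate (E' k) (i - 1)"

definition T_cell :: "nat \<Rightarrow> nat \<Rightarrow> (nat \<times> nat) set" where
  "T_cell k i = {(m, n). flen (2*k+1) \<le> n \<and> n < flen (2*k+2) \<and>
     int (gamma k i) - int (flen (2*k)) < int (n + m) \<and> n + m \<le> gamma k i}"

definition T :: "nat \<Rightarrow> (nat \<times> nat) set" where
  "T k = (\<Union>i\<in>{1..}. T_cell k i)"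

lemma tau_word_append [simp]: "tau_word (u @ v) = tau_word u @ tau_word v"
  by (simp add: tau_word_def)

lemma tau_iter_append: "tau_iter j (u @ v) = tau_iter j u @ tau_iter j v"
  by (induction j) (simp_all add: tau_iter_def)

lemma tau_iter_Suc: "tau_iter (Suc j) w = tau_iter j (tau_word w)"
  unfolding tau_iter_def by (simp only: funpow_Suc_right o_apply)

lemma tau_iter_Suc_True:
  "tau_iter (Suc j) [True] = tau_iter j [True] @ tau_iter j [False] @ tau_iter j [True]"
proof -
  have "tau_word [True] = [True] @ [False] @ [True]" by (simp add: tau_word_def)
  then show ?thesis by (simp only: tau_iter_Suc tau_iter_append)
qed

lemma tau_iter_Suc_False: "tau_iter (Suc j) [False] = tau_iter j [True]"
  by (simp add: tau_iter_Suc tau_word_def)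

lemma less_length_tau_iter: "j < length (tau_iter j [True])"
proof (induction j)
  case 0
  show ?case by (simp add: tau_iter_def)
next
  case (Suc j)
  then show ?case by (simp add: tau_iter_Suc_True)
qed

lemma tau_iter_nth:
  assumes "i < length (tau_iter k [True])"
  shows "tau_iter k [True] ! i = s i"
proof -
  have step: "tau_iter (k + d) [True] ! i = tau_iter k [True] ! i
      \<and> i < length (tau_iter (k + d) [True])"
    if "i < length (tau_iter k [True])" for k d
    using that by (induction d) (simp_all add: tau_iter_Suc_True nth_append)
  have "tau_iter (k + i) [True] ! i = tau_iter k [True] ! i" using step[OF assms] by blast
  moreover have "tau_iter (i + k) [True] ! i = tau_iter i [True] ! i"
    using step[OF less_length_tau_iter] by blast
  ultimately show ?thesis by (simp add: s_def add.commute)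
qed

lemma flen_even: "flen (2 * j) = length (tau_iter j [True])"
  by (simp add: flen_def)

lemma flen_odd: "flen (2 * j + 1) = length (tau_iter j [True]) + length (tau_iter j [False])"
proof -
  have "tau_iter j [True, False] = tau_iter j [True] @ tau_iter j [False]"
    using tau_iter_append[of j "[True]" "[False]"] by simp
  then show ?thesis by (simp add: flen_def)
qed

lemma flen_0: "flen 0 = 1" and flen_1: "flen 1 = 2"
  by (simp_all add: flen_def tau_iter_def)

lemma flen_rec_even: "flen (2 * j + 2) = flen (2 * j) + flen (2 * j + 1)"
  using flen_even[of j] flen_even[of "Suc j"] flen_odd[of j] by (simp add: tau_iter_Suc_True)

lemma flen_rec_odd: "flen (2 * j + 3) = flen (2 * j) + flen (2 * j + 2)"
proof -
  have "2 * j + 3 = 2 * Suc j + 1" "2 * j + 2 = 2 * Suc j" by simp_all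
  then show ?thesis
    by (simp only: flen_even flen_odd tau_iter_Suc_False)
qed

lemma flen_parity: "odd (flen (2 * j)) \<and> even (flen (2 * j + 1))"
proof (induction j)
  case 0
  show ?case using flen_0 flen_1 by simp
next
  case (Suc j)
  then have "odd (flen (2 * j + 2))" "even (flen (2 * j + 3))"
    unfolding flen_rec_odd flen_rec_even by auto
  moreover have "2 * j + 2 = 2 * Suc j" "2 * j + 3 = 2 * Suc j + 1" by simp_all
  ultimately show ?case by (simp only: simp_thms)
qed

end

theory Submission
  imports Defs "HOL-Number_Theory.Cong"
begin

text \<open>Put \<open>A = tau_iter k [True]\<close>, \<open>B = tau_iter k [False]\<close>, of lengths \<open>a\<close> and \<open>b\<close>. The words \<open>AB\<close> and \<open>BA\<close>
  differ exactly by a swap of the two middle letters. Hence around every occurrence of the block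
  \<open>B\<close> the sequence \<open>s\<close> is \<open>a\<close>-periodic except for two adjacent defects, and \<open>gamma k i\<close> marks these
  defects. Reversing columns turns the Hankel matrix into a Toeplitz matrix; subtracting from every row
  the row \<open>a\<close> places above it leaves just a difference of two unit vectors in all but the first \<open>a\<close> rows.
  This reduces the determinant to one of size \<open>a\<close>, all of whose columns but one are cyclic shifts of the
  periodic word. Either two of these shifts coincide and the determinant vanishes, or all columns
  add up to the constant \<open>a\<close>, and the determinant with that column replaced by 1 equals 1.\<close>

subsection \<open>Determinants of matrices given by functions\<close>

text \<open>For \<open>(m, n)\<close> in a cell write \<open>m + n = gamma k i - a + q + 1\<close>
  with \<open>0 \<le> q < a\<close> and \<open>n = a + N\<close> with
  \<open>b \<le> N < a + b\<close>. The unit vectors start at column \<open>q\<close>, and the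
  columns \<open>q\<close> to \<open>q + N\<close> collapse into the one exceptional column. It
  contains a full window of \<open>b\<close> letters, whose count, corrected at the defect, is the
  number of ones in \<open>B\<close>. Since \<open>A\<close> and \<open>B\<close> together contain
  exactly \<open>a\<close> ones, totals equal to \<open>a\<close> arise, and this is the factor
  \<open>flen (2 * k)\<close> of the answer. The columns left and right of the exceptional one
  belong to two families of shifts with relative offset \<open>N - b\<close>. They fit together only
  if \<open>N = b\<close>, if \<open>N = a + b - 1\<close>, or if one side is empty, that is
  \<open>q = 0\<close> or \<open>q = a - 1\<close>; otherwise they overlap modulo \<open>a\<close>.
  The upper bound on \<open>n\<close> keeps all entries in the stretch around a single defect. The
  exponent in (2) is \<open>q\<close> because \<open>Phi k\<close> drops by one with each of the
  fewer than \<open>a\<close> steps down from an element of \<open>E' k\<close>.\<close>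

definition fdet :: "nat \<Rightarrow> (nat \<Rightarrow> nat \<Rightarrow> int) \<Rightarrow> int" where
  "fdet n f = det (mat n n (\<lambda>(i, j). f i j))"

lemma fdet_cong:
  assumes "\<And>i j. i < n \<Longrightarrow> j < n \<Longrightarrow> f i j = g i j"
  shows "fdet n f = fdet n g"
proof -
  have "mat n n (\<lambda>(i, j). f i j) = mat n n (\<lambda>(i, j). g i j)"
    using assms by (intro eq_matI) auto
  then show ?thesis by (simp add: fdet_def)
qed

lemma fdet_mult: "fdet n f * fdet n g = fdet n (\<lambda>i j. \<Sum>l<n. f i l * g l j)"
proof -
  let ?F = "mat n n (\<lambda>(i, j). f i j)" and ?G = "mat n n (\<lambda>(i, j). g i j)"
  have "fdet n f * fdet n g = det (?F * ?G)"
    unfolding fdet_def by (rule det_mult[symmetric]) auto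
  also have "?F * ?G = mat n n (\<lambda>(i, j). \<Sum>l<n. f i l * g l j)"
    by (intro eq_matI) (auto simp: scalar_prod_def lessThan_atLeast0)
  finally show ?thesis by (simp add: fdet_def)
qed

lemma fdet_expand_col:
  assumes "c \<le> n"
  shows "fdet (Suc n) f =
    (\<Sum>i<Suc n. f i c * (-1) ^ (i + c) * fdet n (\<lambda>i' j'. f (insert_index i i') (insert_index c j')))"
proof -
  let ?A = "mat (Suc n) (Suc n) (\<lambda>(i, j). f i j)"
  have "det ?A = (\<Sum>i<Suc n. ?A $$ (i, c) * cofactor ?A i c)"
    using assms by (intro laplace_expansion_column) auto
  also have "\<dots> = (\<Sum>i<Suc n. f i c * (-1) ^ (i + c) *
      fdet n (\<lambda>i' j'. f (insert_index i i') (insert_index c j')))"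
  proof (rule sum.cong[OF refl])
    fix i assume i: "i \<in> {..<Suc n}"
    have "mat_delete ?A i c = mat n n (\<lambda>(i', j'). f (insert_index i i') (insert_index c j'))"
      using assms i by (intro eq_matI) (auto simp: mat_delete_def insert_index_def)
    then show "?A $$ (i, c) * cofactor ?A i c = f i c * (-1) ^ (i + c) *
        fdet n (\<lambda>i' j'. f (insert_index i i') (insert_index c j'))"
      using assms i by (simp add: cofactor_def fdet_def)
  qed
  finally show ?thesis by (simp only: fdet_def)
qed

lemma fdet_expand_last_row:
  "fdet (Suc n) f = (\<Sum>j<Suc n. f n j * (-1) ^ (n + j) * fdet n (\<lambda>i' j'. f i' (insert_index j j')))"
proof -
  let ?A = "mat (Suc n) (Suc n) (\<lambda>(i, j). f i j)"
  have "det ?A = (\<Sum>j<Suc n. ?A $$ (n, j) * cofactor ?A n j)"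
    by (intro laplace_expansion_row) auto
  also have "\<dots> = (\<Sum>j<Suc n. f n j * (-1) ^ (n + j) *
      fdet n (\<lambda>i' j'. f i' (insert_index j j')))"
  proof (rule sum.cong[OF refl])
    fix j assume j: "j \<in> {..<Suc n}"
    have "mat_delete ?A n j = mat n n (\<lambda>(i', j'). f i' (insert_index j j'))"
      using j by (intro eq_matI) (auto simp: mat_delete_def insert_index_def)
    then show "?A $$ (n, j) * cofactor ?A n j = f n j * (-1) ^ (n + j) *
        fdet n (\<lambda>i' j'. f i' (insert_index j j'))"
      using j by (simp add: cofactor_def fdet_def)
  qed
  finally show ?thesis by (simp only: fdet_def)
qed

lemma fdet_column_factor:
  assumes "c < n"
  shows "fdet n (\<lambda>i j. if j = c then x * g i else f i j) = x * fdet n (\<lambda>i j. if j = c then g i else f i j)"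
proof -
  obtain n' where n: "n = Suc n'" using assms by (cases n) auto
  have c: "c \<le> n'" using assms n by simp
  have ne: "insert_index c j \<noteq> c" for j by (simp add: insert_index_def)
  show ?thesis
    unfolding n fdet_expand_col[OF c] sum_distrib_left by (simp add: ne mult.assoc)
qed

lemma fdet_add_col:
  assumes "c < n" "l < n" "c \<noteq> l"
  shows "fdet n (\<lambda>i j. if j = c then x * f i l + f i c else f i j) = fdet n f"
proof -
  let ?A = "mat n n (\<lambda>(i, j). f i j)"
  have "mat n n (\<lambda>(i, j). if j = c then x * f i l + f i c else f i j) = addcol x c l ?A"
    using assms by (intro eq_matI) auto
  then show ?thesis using assms by (simp add: fdet_def)
qed

lemma fdet_add_cols_into:
  assumes "c < n" "I \<subseteq> {..<n}" "c \<notin> I"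
  shows "fdet n (\<lambda>i j. if j = c then f i c + (\<Sum>l\<in>I. x l * f i l) else f i j) = fdet n f"
proof -
  have "finite I" using assms finite_subset by blast
  then show ?thesis using assms
  proof (induction I rule: finite_induct)
    case empty
    show ?case by (simp cong: if_cong) (rule fdet_cong, simp)
  next
    case (insert l I)
    let ?g = "\<lambda>i j. if j = c then f i c + (\<Sum>l\<in>I. x l * f i l) else f i j"
    have "fdet n (\<lambda>i j. if j = c then f i c + (\<Sum>l\<in>insert l I. x l * f i l) else f i j)
      = fdet n (\<lambda>i j. if j = c then x l * ?g i l + ?g i c else ?g i j)"
      using insert by (intro fdet_cong) (auto simp: algebra_simps)
    also have "\<dots> = fdet n ?g" using insert.prems by (intro fdet_add_col) auto
    also have "\<dots> = fdet n f" using insert by auto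
    finally show ?case .
  qed
qed

lemma fdet_add_multiples_of_col:
  assumes "c < n"
  shows "fdet n (\<lambda>i j. if j = c then f i c else f i j + x j * f i c) = fdet n f"
proof -
  have "fdet n (\<lambda>i j. if j \<noteq> c \<and> j \<in> I then f i j + x j * f i c else f i j) = fdet n f"
    if "finite I" "I \<subseteq> {..<n}" for I using that
  proof (induction I rule: finite_induct)
    case empty
    show ?case by simp
  next
    case (insert l I)
    let ?g = "\<lambda>i j. if j \<noteq> c \<and> j \<in> I then f i j + x j * f i c else f i j"
    show ?case
    proof (cases "l = c")
      case True
      have "fdet n (\<lambda>i j. if j \<noteq> c \<and> j \<in> insert l I then f i j + x j * f i c else f i j) = fdet n ?g"
        using True by (intro fdet_cong) auto
      then show ?thesis using insert by simp
    next
      case False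
      have "fdet n (\<lambda>i j. if j \<noteq> c \<and> j \<in> insert l I then f i j + x j * f i c else f i j)
        = fdet n (\<lambda>i j. if j = l then x l * ?g i c + ?g i l else ?g i j)"
        using insert False by (intro fdet_cong) auto
      also have "\<dots> = fdet n ?g" using insert.prems False assms by (intro fdet_add_col) auto
      finally show ?thesis using insert by simp
    qed
  qed
  from this[of "{..<n}"] have "fdet n (\<lambda>i j. if j \<noteq> c \<and> j \<in> {..<n} then f i j + x j * f i c else f i j) = fdet n f"
    by simp
  moreover have "fdet n (\<lambda>i j. if j \<noteq> c \<and> j \<in> {..<n} then f i j + x j * f i c else f i j)
     = fdet n (\<lambda>i j. if j = c then f i c else f i j + x j * f i c)"
    by (intro fdet_cong) auto
  ultimately show ?thesis by simp
qed

lemma fdet_equal_cols: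
  assumes "c < n" "l < n" "c \<noteq> l" "\<And>i. i < n \<Longrightarrow> f i c = f i l"
  shows "fdet n f = 0"
  unfolding fdet_def
  by (rule det_identical_columns[of _ n c l]) (use assms in \<open>auto intro!: eq_vecI\<close>)

lemma fdet_upper_unitriangular:
  assumes "\<And>i j. i < n \<Longrightarrow> j < i \<Longrightarrow> f i j = 0" "\<And>i. i < n \<Longrightarrow> f i i = 1"
  shows "fdet n f = 1"
proof -
  let ?A = "mat n n (\<lambda>(i, j). f i j)"
  have "det ?A = prod_list (diag_mat ?A)"
    using assms by (intro det_upper_triangular) (auto simp: upper_triangular_def)
  also have "diag_mat ?A = replicate n 1"
    using assms by (auto simp: diag_mat_def intro!: nth_equalityI)
  finally show ?thesis by (simp add: fdet_def)
qed

lemma fdet_lower_unitriangular: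
  assumes "\<And>i j. i < j \<Longrightarrow> j < n \<Longrightarrow> f i j = 0" "\<And>i. i < n \<Longrightarrow> f i i = 1"
  shows "fdet n f = 1"
proof -
  let ?A = "mat n n (\<lambda>(i, j). f i j)"
  have "det ?A = prod_list (diag_mat ?A)"
    using assms by (intro det_lower_triangular[of n]) auto
  also have "diag_mat ?A = replicate n 1"
    using assms by (auto simp: diag_mat_def intro!: nth_equalityI)
  finally show ?thesis by (simp add: fdet_def)
qed

lemma fdet_transpose: "fdet n (\<lambda>i j. f j i) = fdet n f"
proof -
  let ?A = "mat n n (\<lambda>(i, j). f i j)"
  have "transpose_mat ?A = mat n n (\<lambda>(i, j). f j i)" by (intro eq_matI) auto
  then show ?thesis using det_transpose[of ?A n] by (simp add: fdet_def)
qed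

lemma fdet_permute_rows:
  assumes "p permutes {..<n}"
  shows "fdet n (\<lambda>i j. f (p i) j) = signof p * fdet n f"
proof -
  let ?A = "mat n n (\<lambda>(i, j). f i j)"
  have p: "p permutes {0..<n}" using assms by (simp add: lessThan_atLeast0)
  have "p i < n" if "i < n" for i using permutes_in_image[OF assms] that by simp
  then have "mat n n (\<lambda>(i, j). f (p i) j) = mat n n (\<lambda>(i, j). ?A $$ (p i, j))"
    by (intro eq_matI) auto
  then show ?thesis using det_permute_rows[OF _ p, of ?A] by (simp add: fdet_def)
qed

lemma fdet_permute_cols:
  assumes "p permutes {..<n}"
  shows "fdet n (\<lambda>i j. f i (p j)) = signof p * fdet n f"
  using fdet_permute_rows[OF assms, of "\<lambda>i j. f j i"] fdet_transpose[of n "\<lambda>i j. f i (p j)"]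
    fdet_transpose[of n f] by simp

text \<open>Expanding the reversed matrix along its first column and the original along its last
  gives corresponding minors, and each enlargement by one column costs \<open>n\<close> further
  transpositions.\<close>

lemma fdet_reverse_cols:
  "fdet n (\<lambda>i j. f i (n - 1 - j)) = (-1) ^ (n * (n - 1) div 2) * fdet n f"
proof (induction n arbitrary: f)
  case 0
  show ?case by (simp add: fdet_def)
next
  case (Suc n)
  have tri: "Suc n * (Suc n - 1) div 2 = n * (n - 1) div 2 + n"
    by (cases n) (simp_all add: algebra_simps)
  have minor: "fdet n (\<lambda>i' j'. f (insert_index i i') (n - Suc j'))
      = (-1) ^ (n * (n - 1) div 2) * fdet n (\<lambda>i' j'. f (insert_index i i') (insert_index n j'))" for i
    unfolding Suc.IH[of "\<lambda>i' j'. f (insert_index i i') (insert_index n j')", symmetric]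
    by (intro fdet_cong) (auto simp: insert_index_def)
  have "fdet (Suc n) (\<lambda>i j. f i (Suc n - 1 - j)) =
      (\<Sum>i<Suc n. f i n * (-1) ^ i * ((-1) ^ (n * (n - 1) div 2) *
        fdet n (\<lambda>i' j'. f (insert_index i i') (insert_index n j'))))"
    by (subst fdet_expand_col[of 0]) (simp_all add: minor del: sum.lessThan_Suc)
  also have "\<dots> = (-1) ^ (n * (n - 1) div 2 + n) * fdet (Suc n) f"
    unfolding fdet_expand_col[OF order_refl, of n f] sum_distrib_left
    by (intro sum.cong refl) (simp add: power_add mult_ac flip: power_mult_distrib)
  finally show ?case unfolding tri .
qed

text \<open>Both sides are expanded along the column that moves: the minors are the same, only the
  checkerboard sign changes.\<close>

lemma fdet_col_to_end:
  assumes "q \<le> n"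
  shows "fdet (Suc n) (\<lambda>i j. if j < q then f i j else if j = n then f i q else f i (Suc j))
    = (-1) ^ (n - q) * fdet (Suc n) f"
proof -
  have "fdet (Suc n) (\<lambda>i j. if j < q then f i j else if j = n then f i q else f i (Suc j))
    = (\<Sum>i<Suc n. f i q * (-1) ^ (i + n) *
        fdet n (\<lambda>i' j'. f (insert_index i i') (insert_index q j')))"
    unfolding fdet_expand_col[OF order_refl]
    using assms by (intro sum.cong refl arg_cong2[where f = "(*)"] fdet_cong) (auto simp: insert_index_def)
  also have "\<dots> = (-1) ^ (n - q) * fdet (Suc n) f"
    unfolding fdet_expand_col[OF assms] sum_distrib_left
  proof (intro sum.cong refl)
    fix i
    have "(-1 :: int) ^ (i + n) = (-1) ^ (n - q) * (-1) ^ (i + q)"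
      using assms by (simp add: add.commute flip: power_add)
    then show "f i q * (-1) ^ (i + n) * fdet n (\<lambda>i' j'. f (insert_index i i') (insert_index q j')) =
         (-1) ^ (n - q) * (f i q * (-1) ^ (i + q) * fdet n (\<lambda>i' j'. f (insert_index i i') (insert_index q j')))"
      by simp
  qed
  finally show ?thesis .
qed

text \<open>The last row has a single entry \<open>c\<close>. Expanding along it leaves a matrix of
  the same kind, with the same sign each time, because row and column index of that entry fall
  together. The first \<open>q\<close> columns and those from \<open>q + N\<close> on
  survive.\<close>

lemma fdet_shifted_scalar_block:
  assumes "q < a"
  shows "fdet (a + N) (\<lambda>i j. if i < a then f i j else if j = q + (i - a) then c else 0)
    = (c * (-1) ^ (a + q)) ^ N * fdet a (\<lambda>i j. f i (if j < q then j else j + N))"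
proof (induction N arbitrary: f)
  case 0
  have "fdet a (\<lambda>i j. if i < a then f i j else if j = q + (i - a) then c else 0)
      = fdet a (\<lambda>i j. f i (if j < q then j else j + 0))"
    by (intro fdet_cong) auto
  then show ?case by simp
next
  case (Suc N)
  let ?F = "\<lambda>i j. if i < a then f i j else if j = q + (i - a) then c else 0"
  let ?g = "\<lambda>i j. f i (insert_index (q + N) j)"
  have sign: "(-1 :: int) ^ (a + N + (q + N)) = (-1) ^ (a + q)"
    by (simp add: power_add mult_ac flip: power_mult_distrib)
  have "fdet (Suc (a + N)) ?F = (\<Sum>j<Suc (a + N). ?F (a + N) j * (-1) ^ (a + N + j) *
      fdet (a + N) (\<lambda>i' j'. ?F i' (insert_index j j')))"
    by (rule fdet_expand_last_row)
  also have "\<dots> = (\<Sum>j<Suc (a + N). if j = q + N then c * (-1) ^ (a + q) *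
      fdet (a + N) (\<lambda>i' j'. ?F i' (insert_index (q + N) j')) else 0)"
    by (intro sum.cong refl) (auto simp: sign)
  also have "\<dots> = c * (-1) ^ (a + q) * fdet (a + N) (\<lambda>i' j'. ?F i' (insert_index (q + N) j'))"
    using assms by (subst sum.delta) auto
  also have "fdet (a + N) (\<lambda>i' j'. ?F i' (insert_index (q + N) j'))
    = fdet (a + N) (\<lambda>i j. if i < a then ?g i j else if j = q + (i - a) then c else 0)"
    by (intro fdet_cong) (auto simp: insert_index_def)
  also have "\<dots> = (c * (-1) ^ (a + q)) ^ N * fdet a (\<lambda>i j. ?g i (if j < q then j else j + N))"
    by (rule Suc.IH)
  also have "fdet a (\<lambda>i j. ?g i (if j < q then j else j + N))
      = fdet a (\<lambda>i j. f i (if j < q then j else j + Suc N))"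
    by (intro fdet_cong) (auto simp: insert_index_def)
  finally show ?case by (simp add: mult_ac)
qed

subsection \<open>Circulant determinants\<close>

lemma periodic_int_mult:
  fixes f :: "int \<Rightarrow> 'b"
  assumes "\<And>x. f (x + int a) = f x"
  shows "f (x + int a * y) = f x"
proof (induction y rule: int_induct[where k = 0])
  case base
  show ?case by simp
next
  case (step1 i)
  then show ?case using assms[of "x + int a * i"] by (simp add: algebra_simps)
next
  case (step2 i)
  then show ?case using assms[of "x + int a * (i - 1)"] by (simp add: algebra_simps)
qed

lemma periodic_dvd_cong:
  fixes f :: "int \<Rightarrow> 'b"
  assumes "\<And>x. f (x + int a) = f x" and "int a dvd x - y"
  shows "f x = f y"
proof -
  from assms(2) obtain z where "x - y = int a * z" by (elim dvdE)
  then have "x = y + int a * z" by simp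
  then show ?thesis using periodic_int_mult[of f a y z] assms(1) by simp
qed

lemma sum_period_shift:
  fixes f :: "int \<Rightarrow> int"
  assumes "\<And>x. f (x + int a) = f x"
  shows "(\<Sum>i<a. f (c + int i)) = (\<Sum>i<a. f (int i))"
proof -
  have step: "(\<Sum>i<a. f (c + 1 + int i)) = (\<Sum>i<a. f (c + int i))" for c
    using sum.lessThan_Suc[of "\<lambda>i. f (c + int i)" a] sum.lessThan_Suc_shift[of "\<lambda>i. f (c + int i)" a]
      assms[of c] by (simp add: algebra_simps)
  show ?thesis
  proof (induction c rule: int_induct[where k = 0])
    case base
    show ?case by simp
  next
    case (step1 i)
    then show ?case using step[of i] by simp
  next
    case (step2 i)
    then show ?case using step[of "i - 1"] by simp
  qed
qed

lemma sum_period_reflect: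
  fixes f :: "int \<Rightarrow> int"
  assumes "\<And>x. f (x + int a) = f x"
  shows "(\<Sum>i<a. f (c - int i)) = (\<Sum>i<a. f (int i))"
proof -
  have "(\<Sum>i<a. f (c - int i)) = (\<Sum>i<a. f (c - int (a - Suc i)))"
    by (rule sum.nat_diff_reindex[symmetric])
  also have "\<dots> = (\<Sum>i<a. f ((c - int a + 1) + int i))"
    by (intro sum.cong refl arg_cong[where f = f]) auto
  finally show ?thesis using sum_period_shift[of f a, OF assms] by simp
qed

text \<open>As a function of \<open>i - j\<close> this is the identity matrix, and with a shifted
  argument a power of the cyclic shift matrix.\<close>

definition ind :: "nat \<Rightarrow> int \<Rightarrow> int" where
  "ind a x = of_bool (int a dvd x)"

lemma ind_periodic: "ind a (x + int a) = ind a x"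
  by (simp add: ind_def)

lemma ind_minus: "ind a (- x) = ind a x"
  by (simp add: ind_def)

lemma ind_diff_commute: "ind a (x - y) = ind a (y - x)"
  using ind_minus[of a "y - x"] by simp

lemma sum_ind_mult:
  fixes f :: "int \<Rightarrow> int"
  assumes "\<And>x. f (x + int a) = f x" "0 < a"
  shows "(\<Sum>l<a. ind a (int l - x) * f (int l)) = f x"
proof -
  have "(\<Sum>l<a. ind a (int l - x) * f (int l)) = (\<Sum>l<a. ind a (x + int l - x) * f (x + int l))"
    by (rule sum_period_shift[symmetric, of "\<lambda>y. ind a (y - x) * f y" a])
       (use assms ind_periodic[of a "_ - x"] in \<open>simp add: algebra_simps\<close>)
  also have "\<dots> = (\<Sum>l<a. if l = 0 then f x else 0)"
  proof (intro sum.cong refl)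
    fix l assume "l \<in> {..<a}"
    then show "ind a (x + int l - x) * f (x + int l) = (if l = 0 then f x else 0)"
      by (auto simp: ind_def dest: zdvd_imp_le)
  qed
  also have "\<dots> = f x" using assms(2) by simp
  finally show ?thesis .
qed

lemma sum_ind: "0 < a \<Longrightarrow> (\<Sum>l<a. ind a (int l - x)) = 1"
  using sum_ind_mult[of "\<lambda>_. 1" a x] by simp

text \<open>Changing \<open>c\<close> by one rotates the \<open>a\<close> columns cyclically, an
  even permutation because \<open>a\<close> is odd.\<close>

lemma circulant_shift:
  fixes f :: "int \<Rightarrow> int"
  assumes "\<And>x. f (x + int a) = f x" "odd a"
  shows "fdet a (\<lambda>i j. f (int i - int j + c)) = fdet a (\<lambda>i j. f (int i - int j))"
proof -
  obtain n where n: "a = Suc n" and "even n" using assms(2) by (cases a) auto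
  have step: "fdet a (\<lambda>i j. f (int i - int j + (c - 1))) = fdet a (\<lambda>i j. f (int i - int j + c))" for c
  proof -
    let ?g = "\<lambda>i j. f (int i - int j + c)"
    have "fdet (Suc n) (\<lambda>i j. if j < 0 then ?g i j else if j = n then ?g i 0 else ?g i (Suc j))
       = (-1) ^ (n - 0) * fdet (Suc n) ?g"
      by (rule fdet_col_to_end) simp
    moreover have "fdet (Suc n) (\<lambda>i j. if j < 0 then ?g i j else if j = n then ?g i 0 else ?g i (Suc j))
       = fdet (Suc n) (\<lambda>i j. f (int i - int j + (c - 1)))"
    proof (intro fdet_cong)
      fix i j
      have "f (int i - int n + (c - 1)) = f (int i + c)"
        using assms(1)[of "int i - int n + (c - 1)"] by (simp add: n algebra_simps)
      then show "(if j < 0 then ?g i j else if j = n then ?g i 0 else ?g i (Suc j)) =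
          f (int i - int j + (c - 1))"
        by (auto simp: algebra_simps)
    qed
    ultimately show ?thesis using \<open>even n\<close> n by simp
  qed
  show ?thesis
  proof (induction c rule: int_induct[where k = 0])
    case base
    show ?case by simp
  next
    case (step1 i)
    then show ?case using step[of "i + 1"] by simp
  next
    case (step2 i)
    then show ?case using step[of i] by simp
  qed
qed

text \<open>Multiplication by \<open>u\<close> permutes the residues modulo \<open>a\<close>. It
  acts on rows and columns at once, so its sign enters squared.\<close>

lemma circulant_dilate:
  fixes f :: "int \<Rightarrow> int"
  assumes "\<And>x. f (x + int a) = f x" "0 < a" "coprime u (int a)"
  shows "fdet a (\<lambda>i j. f (u * (int i - int j))) = fdet a (\<lambda>i j. f (int i - int j))"
proof -
  define p where "p i = (if i < a then nat (u * int i mod int a) else i)" for i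
  have less: "p i < a" if "i < a" for i
    using that assms(2) by (simp add: p_def nat_less_iff)
  have inj: "inj_on p {..<a}"
  proof (rule inj_onI)
    fix i j assume ij: "i \<in> {..<a}" "j \<in> {..<a}" "p i = p j"
    then have "u * int i mod int a = u * int j mod int a"
      using assms(2) by (simp add: p_def nat_eq_iff)
    then have "[u * int i = u * int j] (mod int a)" by (simp add: cong_def)
    then have "[int i = int j] (mod int a)"
      using cong_mult_lcancel[OF assms(3)] by blast
    then show "i = j" using ij by (simp add: cong_def)
  qed
  have perm: "p permutes {..<a}"
  proof (rule bij_imp_permutes)
    show "bij_betw p {..<a} {..<a}"
      by (rule bij_betw_imageI[OF inj], rule endo_inj_surj[OF _ _ inj]) (use less in auto)
  qed (simp add: p_def)
  have "fdet a (\<lambda>i j. f (u * (int i - int j))) = fdet a (\<lambda>i j. f (int (p i) - int (p j)))"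
  proof (rule fdet_cong)
    fix i j assume ij: "i < a" "j < a"
    have "int a dvd u * int i - int (p i)" "int a dvd u * int j - int (p j)"
      using ij assms(2) by (simp_all add: p_def)
    then have "int a dvd (u * int i - int (p i)) - (u * int j - int (p j))" by (rule dvd_diff)
    then have "int a dvd u * (int i - int j) - (int (p i) - int (p j))"
      by (simp add: algebra_simps)
    then show "f (u * (int i - int j)) = f (int (p i) - int (p j))"
      using periodic_dvd_cong[of f a] assms(1) by blast
  qed
  also have "\<dots> = signof p * fdet a (\<lambda>i j. f (int i - int (p j)))"
    using fdet_permute_rows[OF perm, of "\<lambda>i j. f (int i - int (p j))"] by simp
  also have "\<dots> = signof p * (signof p * fdet a (\<lambda>i j. f (int i - int j)))"
    using fdet_permute_cols[OF perm, of "\<lambda>i j. f (int i - int j)"] by simp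
  also have "signof p * signof p = (1 :: int)" by (simp add: sign_def)
  then have "signof p * (signof p * fdet a (\<lambda>i j. f (int i - int j))) = fdet a (\<lambda>i j. f (int i - int j))"
    by (simp flip: mult.assoc)
  finally show ?thesis .
qed

text \<open>Shifting by \<open>v\<close> and dilating by \<open>u - v\<close> reduces every pair of
  residues with invertible difference to the pair \<open>1\<close>, \<open>0\<close>.\<close>

lemma fdet_ind_diff:
  assumes "odd a" "coprime (u - v) (int a)"
  shows "fdet a (\<lambda>i j. ind a (int i - int j - u) - ind a (int i - int j - v) + 1)
    = fdet a (\<lambda>i j. ind a (int i - int j - 1) - ind a (int i - int j) + 1)"
proof -
  have a: "0 < a" using assms(1) by (rule odd_pos)
  have per: "ind a (x + int a - y) = ind a (x - y)" for x y
    using ind_periodic[of a "x - y"] by (simp add: algebra_simps)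
  let ?f = "\<lambda>x. ind a (x - u) - ind a (x - v) + 1" and ?g = "\<lambda>x. ind a (x - (u - v)) - ind a x + 1"
  have "fdet a (\<lambda>i j. ?f (int i - int j)) = fdet a (\<lambda>i j. ?f (int i - int j + v))"
    by (rule circulant_shift[symmetric]) (simp_all add: per assms)
  also have "\<dots> = fdet a (\<lambda>i j. ?g (int i - int j))"
    by (intro fdet_cong) (simp add: algebra_simps)
  also have "\<dots> = fdet a (\<lambda>i j. ?g ((u - v) * (int i - int j)))"
    by (rule circulant_dilate[symmetric]) (simp_all add: per ind_periodic a assms)
  also have "\<dots> = fdet a (\<lambda>i j. ind a (int i - int j - 1) - ind a (int i - int j) + 1)"
  proof (intro fdet_cong)
    fix i j
    have dvd: "ind a ((u - v) * x) = ind a x" for x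
      using assms(2) by (simp add: ind_def coprime_dvd_mult_right_iff coprime_commute)
    have "(u - v) * (int i - int j) - (u - v) = (u - v) * (int i - int j - 1)"
      by (simp add: algebra_simps)
    then show "?g ((u - v) * (int i - int j)) = ind a (int i - int j - 1) - ind a (int i - int j) + 1"
      by (simp only: dvd)
  qed
  finally show ?thesis .
qed

text \<open>A kernel vector \<open>V\<close>, continued periodically, satisfies
  \<open>V (i - 1) - V i + S = 0\<close>, where \<open>S\<close> is the sum of its entries. Adding
  all rows telescopes around the cycle to \<open>a * S = 0\<close>; hence \<open>V\<close> is
  constant, and \<open>S = 0\<close> makes the constant zero.\<close>

lemma fdet_ind_diff_nonzero:
  assumes "0 < a"
  shows "fdet a (\<lambda>i j. ind a (int i - int j - 1) - ind a (int i - int j) + 1) \<noteq> 0"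
proof
  let ?A = "mat a a (\<lambda>(i, j). ind a (int i - int j - 1) - ind a (int i - int j) + 1)"
  assume "fdet a (\<lambda>i j. ind a (int i - int j - 1) - ind a (int i - int j) + 1) = 0"
  then have "det ?A = 0" by (simp add: fdet_def)
  then obtain v where v: "v \<in> carrier_vec a" "v \<noteq> 0\<^sub>v a" "?A *\<^sub>v v = 0\<^sub>v a"
    using det_0_iff_vec_prod_zero[of ?A a] by auto
  define V where "V x = v $ nat (x mod int a)" for x :: int
  have V: "V (x + int a) = V x" for x by (simp add: V_def)
  have Vv: "V (int j) = v $ j" if "j < a" for j using that by (simp add: V_def)
  define S where "S = (\<Sum>j<a. V (int j))"
  have row: "V (int i - 1) - V (int i) + S = 0" if i: "i < a" for i
  proof -
    have "0 = (?A *\<^sub>v v) $ i" using v(3) i by simp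
    also have "\<dots> = (\<Sum>j<a. (ind a (int i - int j - 1) - ind a (int i - int j) + 1) * v $ j)"
      using i v(1) by (auto simp: scalar_prod_def lessThan_atLeast0)
    also have "\<dots> = (\<Sum>j<a. ind a (int j - (int i - 1)) * V (int j) - ind a (int j - int i) * V (int j) + V (int j))"
      by (intro sum.cong refl)
         (use ind_diff_commute[of a "int i - 1"] ind_diff_commute[of a "int i"] in
           \<open>auto simp: Vv algebra_simps\<close>)
    also have "\<dots> = V (int i - 1) - V (int i) + S"
      by (simp add: sum.distrib sum_subtractf sum_ind_mult[of V a, OF V assms] S_def)
    finally show ?thesis by simp
  qed
  have "(\<Sum>i<a. V (int i - 1)) = S"
    using sum_period_shift[of V a "-1", OF V] by (simp add: S_def)
  then have "(\<Sum>i<a. V (int i - 1) - V (int i) + S) = int a * S"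
    by (simp add: sum.distrib sum_subtractf S_def)
  then have S0: "S = 0" using row assms by simp
  have const: "V (int i) = V 0" if "i < a" for i using that
  proof (induction i)
    case (Suc i)
    then show ?case using row[of "Suc i"] S0 by simp
  qed simp
  then have "S = int a * V 0" by (simp add: S_def)
  then have "V 0 = 0" using S0 assms by simp
  then have "v = 0\<^sub>v a" using const Vv v(1) by (intro eq_vecI) auto
  then show False using v(2) by simp
qed

text \<open>Multiplying by the invertible circulant \<open>\<epsilon> (S - I) + J\<close>, where \<open>S\<close> is the cyclic shift by \<open>b\<close> and \<open>J\<close> is the all-ones matrix,
  turns \<open>l\<close> into a difference of two adjacent indicators; up to columns proportional to the
  constant one, the product is again of the form covered by \<open>fdet_ind_diff\<close>.\<close>

lemma circulant_with_constant_column: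
  fixes l :: "int \<Rightarrow> int" and b h c \<epsilon> :: int
  assumes a: "odd a" and per: "\<And>x. l (x + int a) = l x"
    and cop: "coprime b (int a)" and \<epsilon>: "\<epsilon> = 1 \<or> \<epsilon> = -1"
    and diff: "\<And>x. l (x - b) - l x = \<epsilon> * (ind a (x - h + 1) - ind a (x - h))"
    and j0: "j0 < a"
  shows "fdet a (\<lambda>i j. if j = j0 then 1 else l (c + int i - int j)) = 1"
proof -
  have a0: "0 < a" using a by (rule odd_pos)
  \<comment> \<open>\<open>\<Delta>\<close> is never evaluated: it is the determinant of the
    multiplier \<open>E\<close> and also that of the product, and it cancels.\<close>
  define \<Delta> where "\<Delta> = fdet a (\<lambda>i j. ind a (int i - int j - 1) - ind a (int i - int j) + 1)"
  define E where "E i j = \<epsilon> * (ind a (int i - int j - b) - ind a (int i - int j)) + 1" for i j :: nat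
  define X where "X i j = ind a (int i - int j - (h - 1 - c)) - ind a (int i - int j - (h - c))" for i j :: nat
  define S where "S = (\<Sum>i<a. l (int i))"
  let ?C = "\<lambda>i j. if j = j0 then 1 else l (c + int i - int j)"
  have detE: "fdet a E = \<Delta>"
  proof (cases "\<epsilon> = 1")
    case True
    then show ?thesis using fdet_ind_diff[of a b 0] a cop by (simp add: E_def[abs_def] \<Delta>_def)
  next
    case False
    then show ?thesis using fdet_ind_diff[of a 0 b] a cop \<epsilon>
      by (simp add: E_def[abs_def] \<Delta>_def)
  qed
  have sumX: "(\<Sum>j<a. X i j) = 0" for i
  proof -
    have "X i j = ind a (int j - (int i - (h - 1 - c))) - ind a (int j - (int i - (h - c)))" for j
      using ind_diff_commute[of a "int j" "int i - (h - 1 - c)"] ind_diff_commute[of a "int j" "int i - (h - c)"]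
      by (simp add: X_def algebra_simps)
    then show ?thesis by (simp add: sum_subtractf sum_ind a0)
  qed
  have detX: "fdet a (\<lambda>i j. X i j + 1) = \<Delta>"
    using fdet_ind_diff[of a "h - 1 - c" "h - c"] a by (simp add: X_def[abs_def] \<Delta>_def)
  \<comment> \<open>The constant column absorbs any constant added to the others. This is applied
    with \<open>x = 1\<close> and with \<open>x = S\<close>, which links the two
    determinants.\<close>
  have to_const: "fdet a (\<lambda>i j. if j = j0 then int a else X i j + x) = int a * fdet a (\<lambda>i j. if j = j0 then 1 else X i j)"
    for x
  proof -
    let ?Z = "\<lambda>i j. if j = j0 then 1 else X i j"
    have "fdet a (\<lambda>i j. if j = j0 then int a else X i j + x)
        = fdet a (\<lambda>i j. if j = j0 then int a * 1 else ?Z i j + x * ?Z i j0)"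
      by (intro fdet_cong) auto
    also have "\<dots> = int a * fdet a (\<lambda>i j. if j = j0 then 1 else ?Z i j + x * ?Z i j0)"
      by (rule fdet_column_factor[OF j0])
    also have "fdet a (\<lambda>i j. if j = j0 then 1 else ?Z i j + x * ?Z i j0)
        = fdet a (\<lambda>i j. if j = j0 then ?Z i j0 else ?Z i j + x * ?Z i j0)"
      by (intro fdet_cong) auto
    also have "\<dots> = fdet a ?Z" by (rule fdet_add_multiples_of_col[OF j0])
    finally show ?thesis .
  qed
  have "\<Delta> = fdet a (\<lambda>i j. if j = j0 then int a else X i j + 1)"
  proof -
    have "(X i j0 + 1) + (\<Sum>m\<in>{..<a} - {j0}. 1 * (X i m + 1)) = int a" for i
    proof -
      have "(X i j0 + 1) + (\<Sum>m\<in>{..<a} - {j0}. (X i m + 1)) = (\<Sum>m<a. X i m + 1)"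
        using j0 by (subst sum.remove[of "{..<a}" j0]) auto
      then show ?thesis by (simp add: sum.distrib sumX)
    qed
    then have "(if j = j0 then int a else X i j + 1) =
        (if j = j0 then (X i j0 + 1) + (\<Sum>m\<in>{..<a} - {j0}. 1 * (X i m + 1)) else X i j + 1)" for i j
      by (simp only:)
    then have "fdet a (\<lambda>i j. if j = j0 then int a else X i j + 1) = fdet a (\<lambda>i j. X i j + 1)"
      using fdet_add_cols_into[OF j0, of "{..<a} - {j0}" "\<lambda>i j. X i j + 1" "\<lambda>_. 1"] by simp
    then show ?thesis using detX by simp
  qed
  then have \<Delta>: "\<Delta> = int a * fdet a (\<lambda>i j. if j = j0 then 1 else X i j)" by (simp only: to_const)
  \<comment> \<open>Outside column \<open>j0\<close> the factor \<open>\<epsilon>\<close> of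
    \<open>E\<close> meets the one in \<open>diff\<close>, and they multiply to 1; the all-ones part
    of \<open>E\<close> adds the period sum \<open>S\<close>.\<close>
  have prod: "(\<Sum>m<a. E i m * ?C m j) = (if j = j0 then int a else X i j + S)" for i j
  proof -
    have E': "E i m = \<epsilon> * (ind a (int m - (int i - b)) - ind a (int m - int i)) + 1" for m
      using ind_diff_commute[of a "int m" "int i - b"] ind_diff_commute[of a "int m" "int i"]
      by (simp add: E_def algebra_simps)
    show ?thesis
    proof (cases "j = j0")
      case True
      then show ?thesis
        by (simp add: E' sum.distrib sum_subtractf sum_distrib_left[symmetric] sum_ind a0)
    next
      case False
      let ?f = "\<lambda>x. l (c + x - int j)"
      have pf: "?f (x + int a) = ?f x" for x using per[of "c + x - int j"] by (simp add: algebra_simps)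
      have "(\<Sum>m<a. E i m * ?C m j) = (\<Sum>m<a. \<epsilon> * (ind a (int m - (int i - b)) * ?f (int m) - ind a (int m - int i) * ?f (int m)) + ?f (int m))"
        using False by (intro sum.cong refl) (simp add: E' algebra_simps)
      also have "\<dots> = \<epsilon> * (?f (int i - b) - ?f (int i)) + (\<Sum>m<a. ?f (int m))"
        by (simp add: sum.distrib sum_subtractf sum_distrib_left[symmetric] sum_ind_mult[of ?f a, OF pf a0])
      also have "(\<Sum>m<a. ?f (int m)) = S"
        using sum_period_shift[of l a "c - int j", OF per] by (simp add: S_def algebra_simps)
      also have "?f (int i - b) - ?f (int i) = \<epsilon> * X i j"
        using diff[of "c + int i - int j"] by (simp add: X_def algebra_simps)
      finally show ?thesis using False \<epsilon> by auto
    qed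
  qed
  have "\<Delta> * fdet a ?C = fdet a (\<lambda>i j. if j = j0 then int a else X i j + S)"
    unfolding detE[symmetric] fdet_mult prod ..
  also have "\<dots> = \<Delta>" by (simp only: to_const \<Delta>)
  finally have "\<Delta> * fdet a ?C = \<Delta>" .
  moreover have "\<Delta> \<noteq> 0" using fdet_ind_diff_nonzero[OF a0] by (simp add: \<Delta>_def)
  ultimately show ?thesis by simp
qed

subsection \<open>Toeplitz matrices over a word with a single defect\<close>

lemma sum_ivl_shift: "sum f {m..<n} = (\<Sum>t<n - m. f (m + t))" for m n :: nat
  using sum.atLeastLessThan_shift_0[of f m n] by (simp add: lessThan_atLeast0)

text \<open>The situation around one block \<open>B\<close> that starts at position 0:
  \<open>l\<close> is the \<open>A\<close>-periodic word, \<open>w\<close> the actual letters.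
  \<open>w\<close> follows \<open>l\<close> up to the first defect at \<open>h - 1\<close>, and
  \<open>l\<close> delayed by \<open>b\<close> from \<open>h - a + 1\<close> on;
  \<open>l_diff\<close> reconciles the two descriptions.\<close>

locale toeplitz_window =
  fixes a b h q N :: nat and \<epsilon> :: int and l w :: "int \<Rightarrow> int"
  assumes odd_a: "odd a" and b_pos: "0 < b" and b_le_a: "b \<le> a" and two_h: "a + b = 2 * h"
    and coprime_b_a: "coprime (int b) (int a)" and \<epsilon>: "\<epsilon> = 1 \<or> \<epsilon> = -1"
    and per: "\<And>x. l (x + int a) = l x"
    and l_diff: "\<And>x. l (x - int b) - l x = \<epsilon> * (ind a (x - int h + 1) - ind a (x - int h))"
    and w_left: "\<And>x. x \<le> int h - 1 \<Longrightarrow> w x = l x + \<epsilon> * of_bool (x = int h - 1)"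
    and w_right: "\<And>x. int h - int a + 1 \<le> x \<Longrightarrow> w x = l (x - int b)"
    and total: "(\<Sum>t<a. l (int t)) + (\<Sum>t<b. w (int t)) = int a"
    and q_less: "q < a" and N_ge: "b \<le> N" and N_less: "N < a + b"
begin

text \<open>In the application this is the number of ones in \<open>B\<close>.\<close>

definition K :: int where "K = (\<Sum>t<b. w (int t))"

lemma a_pos: "0 < a" using odd_a by (rule odd_pos)

lemma l_cong: "int a dvd x - y \<Longrightarrow> l x = l y"
  using periodic_dvd_cong[of l a x y] per by blast

lemma l_add: "l (x + int a) = l x" "l (x - int a) = l x"
  by (auto intro: l_cong)

lemma w_diff: "w x - w (x - int a) = \<epsilon> * (of_bool (x = int h - 1) - of_bool (x = int h))"
proof -
  consider "x \<le> int h - 1" | "x = int h" | "int h < x" by linarith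
  then show ?thesis
  proof cases
    case 1
    then show ?thesis using w_left[of x] w_left[of "x - int a"] a_pos by (simp add: l_add)
  next
    \<comment> \<open>Here the two descriptions meet: \<open>w_right\<close> gives
      \<open>w x\<close>, \<open>w_left\<close> gives \<open>w (x - a)\<close>, and
      \<open>l_diff\<close> compares them. For \<open>a = 1\<close> the position
      \<open>x - a\<close> is itself the defect \<open>h - 1\<close>.\<close>
    case 2
    have "w x = l (int h - int b)" using 2 w_right[of x] a_pos by simp
    moreover have "w (x - int a) = l (int h) + \<epsilon> * of_bool (a = 1)"
      using 2 w_left[of "x - int a"] a_pos by (simp add: l_add)
    moreover have "ind a 1 = of_bool (a = 1)" "ind a 0 = 1" by (auto simp: ind_def)
    ultimately show ?thesis using l_diff[of "int h"] 2 by (simp add: algebra_simps)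
  next
    case 3
    then show ?thesis using w_right[of x] w_right[of "x - int a"] a_pos l_add(2)[of "x - int b"]
      by (simp add: algebra_simps)
  qed
qed

text \<open>Sliding the window by one exchanges \<open>l (x - b)\<close> for \<open>l x\<close>, and
  by \<open>l_diff\<close> the indicator term changes by the opposite amount. The constant is read
  off from the window \<open>{0..<b}\<close>.\<close>

lemma window_sum: "(\<Sum>t<b. l (x - int t)) + \<epsilon> * ind a (x - int h + 1) = K"
proof -
  let ?G = "\<lambda>x. (\<Sum>t<b. l (x - int t)) + \<epsilon> * ind a (x - int h + 1)"
  have step: "?G (x - 1) = ?G x" for x
  proof -
    have "(\<Sum>t<b. l (x - int t)) - (\<Sum>t<b. l (x - 1 - int t)) = l x - l (x - int b)"
      using sum.lessThan_Suc[of "\<lambda>t. l (x - int t)" b] sum.lessThan_Suc_shift[of "\<lambda>t. l (x - int t)" b]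
      by (simp add: algebra_simps)
    then show ?thesis using l_diff[of x] by (simp add: algebra_simps)
  qed
  have base: "?G (int b - 1) = K"
  proof -
    have bh: "b \<le> h" using b_le_a two_h by simp
    have "(\<Sum>t<b. l (int b - 1 - int t)) = (\<Sum>t<b. l (int (b - Suc t)))"
      by (intro sum.cong refl arg_cong[where f = l]) auto
    also have "\<dots> = (\<Sum>t<b. l (int t))" by (rule sum.nat_diff_reindex)
    finally have 1: "(\<Sum>t<b. l (int b - 1 - int t)) = (\<Sum>t<b. l (int t))" .
    have "K = (\<Sum>t<b. l (int t) + \<epsilon> * of_bool (int t = int h - 1))"
      unfolding K_def using bh by (intro sum.cong refl w_left) auto
    also have "\<dots> = (\<Sum>t<b. l (int t)) + \<epsilon> * (\<Sum>t<b. of_bool (int t = int h - 1))"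
      by (simp add: sum.distrib sum_distrib_left)
    \<comment> \<open>Since \<open>b \<le> h\<close>, the defect \<open>h - 1\<close> lies in
      \<open>{0..<b}\<close> only if \<open>b = h\<close>.\<close>
    also have "(\<Sum>t<b. of_bool (int t = int h - 1)) = (\<Sum>t<b. if t = h - 1 then 1 else (0 :: int))"
      using b_pos bh by (intro sum.cong refl) auto
    also have "\<dots> = of_bool (b = h)" using b_pos bh by auto
    also have "(of_bool (b = h) :: int) = ind a (int b - int h)"
    proof (cases "b = h")
      case False
      have "\<not> int a dvd int h - int b"
        using False bh two_h a_pos b_pos by (auto dest!: zdvd_imp_le)
      then show ?thesis using False ind_diff_commute[of a "int b" "int h"] by (simp add: ind_def)
    qed (simp add: ind_def)
    finally show ?thesis by (simp add: 1)
  qed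
  have "?G (int b - 1 + y) = K" for y
  proof (induction y rule: int_induct[where k = 0])
    case base
    show ?case using \<open>?G (int b - 1) = K\<close> by simp
  next
    case (step1 i)
    then show ?case using step[of "int b - 1 + (i + 1)"] by (simp add: algebra_simps)
  next
    case (step2 i)
    then show ?case using step[of "int b - 1 + i"] by (simp add: algebra_simps)
  qed
  from this[of "x - int b + 1"] show ?thesis by simp
qed

text \<open>What the elimination leaves: columns before \<open>q\<close> come from
  \<open>w_right\<close>, those after it from \<open>w_left\<close>. Column \<open>q\<close>
  collects the columns \<open>q\<close> to \<open>q + N\<close>, and its first \<open>b\<close>
  letters together with the defect make up \<open>K\<close>.\<close>

definition minor :: "nat \<Rightarrow> nat \<Rightarrow> int" where
  "minor i j = (if j < q then l (int h - int b + int i + int q - int j)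
     else if j = q then (\<Sum>t\<in>{b..N}. l (int h + int i - int t)) + K
     else l (int h + int i - int N - (int j - int q)))"

abbreviation toep :: "nat \<Rightarrow> nat \<Rightarrow> int" where
  "toep i j \<equiv> w (int h - int a + int q + int i - int j)"

text \<open>Only row \<open>a - 1\<close> meets the defect, in the summand \<open>t = 0\<close>;
  this contribution is exactly the correction term of \<open>window_sum\<close>.\<close>

lemma merged_column:
  assumes "i < a"
  shows "(\<Sum>j\<in>{q..q + N}. toep i j) = minor i q"
proof -
  have "(\<Sum>j\<in>{q..q + N}. toep i j) = (\<Sum>t\<in>{0..N}. w (int h - int a + int i - int t))"
    using sum.shift_bounds_cl_nat_ivl[of "toep i" 0 q N] by (simp add: add.commute algebra_simps)
  also have "\<dots> = (\<Sum>t\<in>{0..N}. l (int h + int i - int t) + (if t = 0 then \<epsilon> * of_bool (i = a - 1) else 0))"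
  proof (intro sum.cong refl)
    fix t
    have "w (int h - int a + int i - int t) = l (int h - int a + int i - int t) + \<epsilon> * of_bool (int h - int a + int i - int t = int h - 1)"
      using assms by (intro w_left) simp
    moreover have "l (int h - int a + int i - int t) = l (int h + int i - int t)"
      by (rule l_cong) simp
    ultimately show "w (int h - int a + int i - int t)
        = l (int h + int i - int t) + (if t = 0 then \<epsilon> * of_bool (i = a - 1) else 0)"
      using assms by auto
  qed
  also have "\<dots> = (\<Sum>t\<in>{0..N}. l (int h + int i - int t)) + \<epsilon> * of_bool (i = a - 1)"
    by (simp add: sum.distrib)
  also have "{0..N} = {..<b} \<union> {b..N}" using N_ge by auto
  also have "(\<Sum>t\<in>{..<b} \<union> {b..N}. l (int h + int i - int t))
      = (\<Sum>t<b. l (int h + int i - int t)) + (\<Sum>t\<in>{b..N}. l (int h + int i - int t))"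
    by (intro sum.union_disjoint) auto
  also have "(of_bool (i = a - 1) :: int) = ind a (int h + int i - int h + 1)"
  proof -
    have "int a dvd int i + 1 \<longleftrightarrow> i = a - 1"
      using assms by (auto dest!: zdvd_imp_le)
    then show ?thesis by (simp add: ind_def)
  qed
  finally show ?thesis using window_sum[of "int h + int i"] by (simp add: minor_def)
qed

text \<open>\<open>L\<close> carries out the row subtraction. \<open>U\<close> forms cumulative sums
  over the columns \<open>q\<close> to \<open>q + N\<close>, which telescope each difference of
  adjacent unit vectors to the single entry \<open>- \<epsilon>\<close>; the last \<open>N\<close>
  rows then form a shifted scalar block.\<close>

lemma toeplitz_det_eq_minor: "fdet (a + N) toep = (\<epsilon> * (-1) ^ q) ^ N * fdet a minor"
proof -
  define R where "R i j = (if i < a then toep i j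
      else \<epsilon> * (of_bool (j = q + (i - a) + 1) - of_bool (j = q + (i - a))))" for i j
  define L where "L i j = (if i = j then 1 else if i = j + a then - 1 else 0 :: int)" for i j :: nat
  define U where "U i j = (if q \<le> j \<and> j \<le> q + N then of_bool (q \<le> i \<and> i \<le> j) else of_bool (i = j) :: int)"
    for i j :: nat
  define F where "F i j = (if q \<le> j \<and> j \<le> q + N then (\<Sum>j'\<in>{q..j}. toep i j') else toep i j)" for i j
  have "fdet (a + N) L = 1"
    by (rule fdet_lower_unitriangular) (auto simp: L_def)
  then have "fdet (a + N) toep = fdet (a + N) L * fdet (a + N) toep" by simp
  also have "\<dots> = fdet (a + N) R"
    unfolding fdet_mult
  proof (intro fdet_cong)
    fix i j assume ij: "i < a + N" "j < a + N"
    have "(\<Sum>i'<a + N. L i i' * toep i' j) =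
        (\<Sum>i'<a + N. (if i' = i then toep i j else 0) + (if i' = i - a then (if a \<le> i then - toep (i - a) j else 0) else 0))"
      by (intro sum.cong refl) (use a_pos in \<open>auto simp: L_def\<close>)
    also have "\<dots> = toep i j + (if a \<le> i then - toep (i - a) j else 0)"
      using ij by (simp add: sum.distrib less_imp_diff_less)
    also have "\<dots> = R i j"
    proof (cases "i < a")
      case False
      then obtain r where r: "i = a + r" by (metis le_iff_add not_less)
      have "toep i j - toep (i - a) j = \<epsilon> * (of_bool (j = q + r + 1) - of_bool (j = q + r))"
      proof -
        have "toep i j - toep (i - a) j = w (int h + int q + int r - int j) - w (int h + int q + int r - int j - int a)"
          by (simp add: r algebra_simps)
        moreover have "int h + int q + int r - int j = int h - 1 \<longleftrightarrow> j = q + r + 1"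
          "int h + int q + int r - int j = int h \<longleftrightarrow> j = q + r" by auto
        ultimately show ?thesis by (simp only: w_diff)
      qed
      then show ?thesis using r by (simp add: R_def)
    qed (simp add: R_def)
    finally show "(\<Sum>i'<a + N. L i i' * toep i' j) = R i j" .
  qed
  also have "\<dots> = fdet (a + N) R * fdet (a + N) U"
    using fdet_upper_unitriangular[of "a + N" U] by (auto simp: U_def)
  also have "\<dots> = fdet (a + N) (\<lambda>i j. if i < a then F i j else if j = q + (i - a) then - \<epsilon> else 0)"
    unfolding fdet_mult
  proof (intro fdet_cong)
    fix i j assume ij: "i < a + N" "j < a + N"
    have sumU: "(\<Sum>j'<a + N. R i j' * U j' j) = (if q \<le> j \<and> j \<le> q + N then (\<Sum>j'\<in>{q..j}. R i j') else R i j)"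
    proof (cases "q \<le> j \<and> j \<le> q + N")
      case True
      have "(\<Sum>j'<a + N. R i j' * U j' j) = (\<Sum>j'<a + N. if j' \<in> {q..j} then R i j' else 0)"
        using True by (intro sum.cong refl) (simp add: U_def)
      also have "\<dots> = (\<Sum>j'\<in>{..<a + N} \<inter> {q..j}. R i j')"
        by (rule sum.inter_restrict[symmetric]) simp
      also have "{..<a + N} \<inter> {q..j} = {q..j}" using ij by auto
      finally show ?thesis using True by simp
    next
      case False
      have "(\<Sum>j'<a + N. R i j' * U j' j) = (\<Sum>j'<a + N. if j' = j then R i j else 0)"
        using False by (intro sum.cong refl) (auto simp: U_def)
      then show ?thesis using ij False by auto
    qed
    show "(\<Sum>j'<a + N. R i j' * U j' j) = (if i < a then F i j else if j = q + (i - a) then - \<epsilon> else 0)"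
    proof (cases "i < a")
      case True
      then show ?thesis unfolding sumU by (simp add: R_def F_def)
    next
      case False
      have "(\<Sum>j'\<in>{q..j}. R i j') = \<epsilon> * ((\<Sum>j'\<in>{q..j}. if j' = q + (i - a) + 1 then 1 else 0) - (\<Sum>j'\<in>{q..j}. if j' = q + (i - a) then 1 else 0))"
        using False by (simp add: R_def sum_distrib_left[symmetric] sum_subtractf of_bool_def)
      then show ?thesis unfolding sumU using False ij by (auto simp: R_def)
    qed
  qed
  also have "\<dots> = (- \<epsilon> * (-1) ^ (a + q)) ^ N * fdet a (\<lambda>i j. F i (if j < q then j else j + N))"
    by (rule fdet_shifted_scalar_block[OF q_less])
  also have "fdet a (\<lambda>i j. F i (if j < q then j else j + N)) = fdet a minor"
  proof (intro fdet_cong)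
    fix i j assume ij: "i < a" "j < a"
    consider "j < q" | "j = q" | "q < j" by linarith
    then show "F i (if j < q then j else j + N) = minor i j"
    proof cases
      case 1
      have "toep i j = l (int h - int a + int q + int i - int j - int b)"
        using 1 by (intro w_right) simp
      also have "\<dots> = l (int h - int b + int i + int q - int j)" by (rule l_cong) simp
      finally show ?thesis using 1 by (simp add: F_def minor_def)
    next
      case 2
      then show ?thesis using merged_column[OF ij(1)] by (simp add: F_def)
    next
      case 3
      have "toep i (j + N) = l (int h - int a + int q + int i - int (j + N)) +
          \<epsilon> * of_bool (int h - int a + int q + int i - int (j + N) = int h - 1)"
        using 3 ij by (intro w_left) simp
      also have "\<dots> = l (int h - int a + int q + int i - int (j + N))" using 3 ij by simp
      also have "\<dots> = l (int h + int i - int N - (int j - int q))" by (rule l_cong) simp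
      finally show ?thesis using 3 by (simp add: F_def minor_def)
    qed
  qed
  also have "- \<epsilon> * (-1) ^ (a + q) = \<epsilon> * (-1) ^ q" using odd_a by (simp add: power_add)
  finally show ?thesis .
qed

lemma sum_l: "(\<Sum>m<a. l (x - int m)) + K = int a"
  using sum_period_reflect[of l a x, OF per] total by (simp add: K_def)

lemma constant_column:
  assumes "j0 < a"
  shows "fdet a (\<lambda>i j. if j = j0 then int a else l (c + int i - int j)) = int a"
proof -
  have "fdet a (\<lambda>i j. if j = j0 then int a else l (c + int i - int j)) =
      fdet a (\<lambda>i j. if j = j0 then int a * 1 else l (c + int i - int j))"
    by (simp cong: if_cong)
  also have "\<dots> = int a * fdet a (\<lambda>i j. if j = j0 then 1 else l (c + int i - int j))"
    by (rule fdet_column_factor[OF assms])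
  also have "fdet a (\<lambda>i j. if j = j0 then 1 else l (c + int i - int j)) = 1"
    by (rule circulant_with_constant_column[of a l "int b" \<epsilon> "int h"])
       (use odd_a per coprime_b_a \<epsilon> l_diff assms in auto)
  finally show ?thesis by simp
qed

text \<open>Column \<open>q\<close> consists of \<open>K\<close>, the shift missing from the family,
  and additional copies of the shifts in \<open>I\<close>. Adding only the columns outside
  \<open>I\<close> makes every shift occur once, and \<open>sum_l\<close> gives the total
  \<open>a\<close>.\<close>

lemma fdet_minor_from_shifts:
  assumes cols: "\<And>i j. j < a \<Longrightarrow> j \<noteq> q \<Longrightarrow> minor i j = l (c + int i - int j)"
    and I: "I \<subseteq> {..<a}" "q \<notin> I"
    and mid: "\<And>i. (\<Sum>t\<in>{b..N}. l (int h + int i - int t)) = l (c + int i - int q) + (\<Sum>m\<in>I. l (c + int i - int m))"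
  shows "fdet a minor = int a"
proof -
  let ?x = "\<lambda>m. if m \<in> I then 0 else 1 :: int" and ?J = "{..<a} - {q}"
  have "fdet a minor = fdet a (\<lambda>i j. if j = q then minor i q + (\<Sum>m\<in>?J. ?x m * minor i m) else minor i j)"
    using q_less by (intro fdet_add_cols_into[symmetric]) auto
  also have "\<dots> = fdet a (\<lambda>i j. if j = q then int a else l (c + int i - int j))"
  proof (intro fdet_cong)
    fix i j assume "j < a"
    let ?f = "\<lambda>m. l (c + int i - int m)"
    have "(\<Sum>m\<in>?J. ?x m * minor i m) = (\<Sum>m\<in>?J. ?f m - (if m \<in> I then ?f m else 0))"
      by (intro sum.cong refl) (auto simp: cols)
    also have "\<dots> = sum ?f ?J - sum ?f I"
      using I by (simp add: sum_subtractf sum.inter_restrict[symmetric] Int_absorb1 subset_Diff_insert)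
    finally have "minor i q + (\<Sum>m\<in>?J. ?x m * minor i m) = K + (?f q + sum ?f ?J)"
      using mid[of i] by (simp add: minor_def)
    also have "?f q + sum ?f ?J = sum ?f {..<a}"
      using q_less by (intro sum.remove[symmetric]) auto
    finally show "(if j = q then minor i q + (\<Sum>m\<in>?J. ?x m * minor i m) else minor i j) =
         (if j = q then int a else l (c + int i - int j))"
      using sum_l[of "c + int i"] \<open>j < a\<close> by (simp add: cols)
  qed
  also have "\<dots> = int a" by (rule constant_column[OF q_less])
  finally show ?thesis .
qed

text \<open>In these cases the columns other than \<open>q\<close> form one family of consecutive
  shifts: the two sides have equal offset, or one of them is empty.\<close>

lemma fdet_minor_extremal:
  assumes "N = b \<or> q = 0 \<or> q = a - 1"
  shows "fdet a minor = int a"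
proof -
  consider "N = b" | "q = 0" | "q = a - 1" "q \<noteq> 0" using assms by blast
  then show ?thesis
  proof cases
    case 1
    show ?thesis
      by (rule fdet_minor_from_shifts[of "int h - int b + int q" "{}"])
         (unfold minor_def, use 1 in \<open>auto intro!: arg_cong[where f = l]\<close>)
  next
    case 2
    show ?thesis
    \<comment> \<open>The summand \<open>t = N\<close> is the shift belonging to column 0; a summand
      \<open>t < N\<close> belongs, modulo \<open>a\<close>, to column
      \<open>a + t - N\<close>.\<close>
    proof (rule fdet_minor_from_shifts[of "int h - int N" "{a + b - N..<a}"])
      fix i
      show "(\<Sum>t\<in>{b..N}. l (int h + int i - int t)) = l (int h - int N + int i - int q) +
         (\<Sum>m\<in>{a + b - N..<a}. l (int h - int N + int i - int m))"
      proof -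
        have "(\<Sum>m\<in>{a + b - N..<a}. l (int h - int N + int i - int m)) = (\<Sum>t<N - b. l (int h + int i - int (b + t)))"
          unfolding sum_ivl_shift using N_ge N_less by (intro sum.cong l_cong) (auto simp: of_nat_diff)
        also have "\<dots> = (\<Sum>t\<in>{b..<N}. l (int h + int i - int t))" by (rule sum_ivl_shift[symmetric])
        finally show ?thesis using N_ge 2 by (simp add: sum.last_plus algebra_simps)
      qed
    qed (unfold minor_def, use 2 N_less in \<open>auto intro!: arg_cong[where f = l]\<close>)
  next
    case 3
    show ?thesis
    \<comment> \<open>The summand \<open>t = b\<close> is the shift belonging to column
      \<open>a - 1\<close>; the summand \<open>t = b + 1 + m\<close> belongs, modulo
      \<open>a\<close>, to column \<open>m\<close>.\<close>
    proof (rule fdet_minor_from_shifts[of "int h - int b + int q" "{..<N - b}"])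
      fix i
      have "(\<Sum>t\<in>{b..N}. l (int h + int i - int t)) = (\<Sum>t<Suc (N - b). l (int h - int b + int i - int t))"
        unfolding atLeastLessThanSuc_atLeastAtMost[symmetric] sum_ivl_shift
        using N_ge by (intro sum.cong arg_cong[where f = l]) auto
      also have "\<dots> = l (int h - int b + int i) + (\<Sum>t<N - b. l (int h - int b + int i - int (Suc t)))"
        by (simp only: sum.lessThan_Suc_shift) simp
      also have "(\<Sum>t<N - b. l (int h - int b + int i - int (Suc t))) = (\<Sum>m<N - b. l (int h - int b + int q + int i - int m))"
        using 3 a_pos by (intro sum.cong refl l_cong) auto
      finally show "(\<Sum>t\<in>{b..N}. l (int h + int i - int t)) = l (int h - int b + int q + int i - int q) +
         (\<Sum>m<N - b. l (int h - int b + int q + int i - int m))" by (simp add: algebra_simps)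
    qed (unfold minor_def, use 3 N_less q_less in \<open>auto intro!: arg_cong[where f = l]\<close>)
  qed
qed

text \<open>The merged column now runs over a full period, so it is constant without further
  additions. The two sides are offset by \<open>a - 1\<close>, that is \<open>-1\<close> modulo
  \<open>a\<close>, so taking out column \<open>q\<close> closes them up to consecutive
  shifts.\<close>

lemma fdet_minor_maximal:
  assumes "N = a + b - 1"
  shows "fdet a minor = (-1) ^ q * int a"
proof -
  obtain n where n: "a = Suc n" and "even n" using odd_a by (cases a) auto
  have qn: "q \<le> n" using q_less n by simp
  have mid: "minor i q = int a" for i
  proof -
    have "(\<Sum>t\<in>{b..N}. l (int h + int i - int t)) = (\<Sum>t<a. l (int h - int b + int i - int t))"
      unfolding atLeastLessThanSuc_atLeastAtMost[symmetric] sum_ivl_shift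
      using assms a_pos by (intro sum.cong arg_cong[where f = l]) auto
    then show ?thesis using sum_l[of "int h - int b + int i"] by (simp add: minor_def)
  qed
  have "(-1) ^ (n - q) * fdet (Suc n) minor
     = fdet (Suc n) (\<lambda>i j. if j < q then minor i j else if j = n then minor i q else minor i (Suc j))"
    by (rule fdet_col_to_end[OF qn, symmetric])
  also have "\<dots> = fdet a (\<lambda>i j. if j = n then int a else l (int h - int b + int q + int i - int j))"
    unfolding n[symmetric]
  proof (intro fdet_cong)
    fix i j assume ij: "i < a" "j < a"
    have "minor i j = l (int h - int b + int q + int i - int j)" if "j < q"
      using that by (simp add: minor_def algebra_simps)
    moreover have "minor i (Suc j) = l (int h - int b + int q + int i - int j)" if "\<not> j < q"
    proof -
      have "minor i (Suc j) = l (int h + int i - int N - (int (Suc j) - int q))"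
        using that by (simp add: minor_def)
      also have "\<dots> = l (int h - int b + int q + int i - int j)"
        using assms b_pos by (intro l_cong) (simp add: of_nat_diff)
      finally show ?thesis .
    qed
    ultimately show "(if j < q then minor i j else if j = n then minor i q else minor i (Suc j)) =
        (if j = n then int a else l (int h - int b + int q + int i - int j))"
      using qn mid by auto
  qed
  also have "\<dots> = int a" by (rule constant_column) (simp add: n)
  finally have "(-1) ^ (n - q) * fdet a minor = int a" by (simp add: n)
  moreover have "(-1 :: int) ^ (n - q) = (-1) ^ q"
    using \<open>even n\<close> qn by (auto simp: minus_one_power_iff)
  ultimately have "(-1) ^ q * ((-1) ^ q * fdet a minor) = (-1) ^ q * int a" by simp
  then show ?thesis by (simp flip: mult.assoc power_mult_distrib)
qed

text \<open>The columns \<open>q - u\<close> and \<open>q + r\<close> are the same shift as soon as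
  \<open>u + r = a + b - N\<close>. \<open>u\<close> is chosen as large as \<open>u \<le> q\<close>
  and \<open>1 \<le> r\<close> permit; the strict bounds on \<open>N\<close> and \<open>q\<close>
  then keep both columns inside the matrix and away from \<open>q\<close>.\<close>

lemma fdet_minor_zero:
  assumes "b < N" "N < a + b - 1" "0 < q" "q < a - 1"
  shows "fdet a minor = 0"
proof -
  define v where "v = a + b - N"
  define u where "u = min q (v - 1)"
  define r where "r = v - u"
  have *: "u \<le> q" "0 < u" "0 < r" "r \<le> a - 1 - q" "u + r + N = a + b"
    using assms by (auto simp: v_def u_def r_def)
  show ?thesis
  proof (rule fdet_equal_cols[of "q - u" a "q + r"])
    fix i
    have "(int h - int b + int i + int q - int (q - u)) - (int h + int i - int N - (int (q + r) - int q)) = int a"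
      using * by (simp add: of_nat_diff)
    then have "l (int h - int b + int i + int q - int (q - u)) = l (int h + int i - int N - (int (q + r) - int q))"
      by (intro l_cong) simp
    then show "minor i (q - u) = minor i (q + r)" using * by (simp add: minor_def)
  qed (use * assms in auto)
qed

end

subsection \<open>The words of the substitution\<close>

definition wordA :: "nat \<Rightarrow> bool list" where "wordA k = tau_iter k [True]"
definition wordB :: "nat \<Rightarrow> bool list" where "wordB k = tau_iter k [False]"
text \<open>The position, counted from 0, of the second of the two middle letters of
  \<open>AB\<close>.\<close>

definition mid :: "nat \<Rightarrow> nat" where "mid k = flen (2 * k + 1) div 2"

lemma wordA_Suc: "wordA (Suc k) = wordA k @ wordB k @ wordA k"
  by (simp add: wordA_def wordB_def tau_iter_Suc_True)

lemma wordB_Suc: "wordB (Suc k) = wordA k"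
  by (simp add: wordA_def wordB_def tau_iter_Suc_False)

lemma wordA_0: "wordA 0 = [True]" and wordB_0: "wordB 0 = [False]"
  by (simp_all add: wordA_def wordB_def tau_iter_def)

lemma length_wordA: "length (wordA k) = flen (2 * k)"
  by (simp add: wordA_def flen_even)

lemma length_AB: "length (wordA k) + length (wordB k) = flen (2 * k + 1)"
  by (simp only: wordA_def wordB_def flen_odd)

lemma two_mid: "2 * mid k = length (wordA k) + length (wordB k)"
  unfolding length_AB mid_def using flen_parity[of k] by simp

lemma odd_length_wordA: "odd (length (wordA k))"
  using flen_parity[of k] by (simp add: length_wordA)

lemma length_wordB_bounds: "0 < length (wordB k) \<and> length (wordB k) \<le> length (wordA k)"
  by (induction k) (auto simp: wordA_0 wordB_0 wordA_Suc wordB_Suc simp flip: length_greater_0_conv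
    simp del: length_greater_0_conv)

lemma coprime_lengths: "coprime (length (wordB k)) (length (wordA k))"
proof (induction k)
  case 0
  show ?case by (simp add: wordA_0 wordB_0)
next
  case (Suc k)
  then show ?case
    using gcd_add2[of "length (wordA k)" "length (wordB k)"]
    by (simp add: wordA_Suc wordB_Suc coprime_iff_gcd_eq_1 gcd.commute add.commute)
qed

lemma mid_0: "mid 0 = 1"
  using two_mid[of 0] by (simp add: wordA_0 wordB_0)

lemma mid_Suc: "mid (Suc k) = length (wordA k) + mid k"
  using two_mid[of k] two_mid[of "Suc k"] by (simp add: wordA_Suc wordB_Suc)

lemma mid_bounds: "0 < mid k" "mid k \<le> length (wordA k)" "length (wordB k) \<le> mid k"
  using two_mid[of k] length_wordB_bounds[of k] by linarith+

lemma even_mid: "even (mid k) \<longleftrightarrow> odd k"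
  by (induction k) (simp_all add: mid_0 mid_Suc odd_length_wordA)

text \<open>One level up the two words are \<open>A (AB) A\<close> and \<open>A (BA) A\<close>: the
  same pair in a common frame, with exchanged roles. The exchange flips the sign, in accordance with
  \<open>mid\<close>, which changes parity because \<open>a\<close> is odd.\<close>

lemma AB_commute_up_to_swap:
  assumes "i < 2 * mid k"
  shows "of_bool ((wordB k @ wordA k) ! i) - of_bool ((wordA k @ wordB k) ! i) =
    (-1) ^ mid k * (of_bool (i = mid k - 1) - of_bool (i = mid k) :: int)"
  using assms
proof (induction k arbitrary: i)
  case 0
  then have "i = 0 \<or> i = 1" by (auto simp: mid_0)
  then show ?case by (auto simp: wordA_0 wordB_0 mid_0)
next
  case (Suc k)
  let ?A = "wordA k" and ?B = "wordB k"
  have AB: "wordA (Suc k) @ wordB (Suc k) = ?A @ (?B @ ?A) @ ?A"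
    and BA: "wordB (Suc k) @ wordA (Suc k) = ?A @ (?A @ ?B) @ ?A"
    by (simp_all add: wordA_Suc wordB_Suc)
  have sign: "(-1 :: int) ^ mid (Suc k) = - ((-1) ^ mid k)"
    using odd_length_wordA[of k] by (simp add: mid_Suc power_add)
  have two_m: "2 * mid k = length ?A + length ?B" by (rule two_mid)
  consider "i < length ?A" | "length ?A \<le> i" "i - length ?A < 2 * mid k" | "length ?A + 2 * mid k \<le> i"
    by linarith
  then show ?case
  proof cases
    case 1
    then show ?thesis unfolding AB BA mid_Suc using mid_bounds(1)[of k] by (simp add: nth_append)
  next
    case 2
    then obtain t where i: "i = length ?A + t" and t: "t < 2 * mid k" by (metis le_iff_add diff_add_inverse)
    have "(?A @ (?B @ ?A) @ ?A) ! i = (?B @ ?A) ! t" "(?A @ (?A @ ?B) @ ?A) ! i = (?A @ ?B) ! t"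
      using t unfolding i two_m by (simp_all only: nth_append_length_plus) (auto simp: nth_append)
    moreover have "(i = mid (Suc k) - 1) = (t = mid k - 1)" "(i = mid (Suc k)) = (t = mid k)"
      using mid_bounds(1)[of k] by (auto simp: i mid_Suc)
    ultimately show ?thesis using Suc.IH[OF t] unfolding AB BA sign by (simp add: algebra_simps)
  next
    case 3
    define t where "t = i - length (?A @ ?B @ ?A)"
    have i: "i = length (?A @ ?B @ ?A) + t" using 3 two_m by (simp add: t_def)
    have "(?A @ (?B @ ?A) @ ?A) ! i = ?A ! t"
      using nth_append_length_plus[of "?A @ ?B @ ?A" ?A t] unfolding i by simp
    moreover have "(?A @ (?A @ ?B) @ ?A) ! i = ?A ! t"
      using nth_append_length_plus[of "?A @ ?A @ ?B" ?A t] unfolding i by (simp add: add_ac)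
    moreover have "i \<noteq> mid (Suc k) - 1" "i \<noteq> mid (Suc k)"
      using mid_bounds(1)[of k] two_m by (auto simp: i mid_Suc)
    ultimately show ?thesis unfolding AB BA by simp
  qed
qed

lemma AB_commute_nth:
  assumes "i < 2 * mid k" "i \<noteq> mid k - 1" "i \<noteq> mid k"
  shows "(wordB k @ wordA k) ! i = (wordA k @ wordB k) ! i"
  using AB_commute_up_to_swap[OF assms(1)] assms(2,3) by (simp add: of_bool_eq_iff)

definition ones :: "bool list \<Rightarrow> int" where
  "ones u = (\<Sum>x\<leftarrow>u. of_bool x)"

lemma ones_append: "ones (u @ v) = ones u + ones v"
  by (simp add: ones_def)

lemma ones_conv_sum: "ones u = (\<Sum>t<length u. of_bool (u ! t))"
  by (simp add: ones_def sum_list_sum_nth lessThan_atLeast0)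

text \<open>Each identity needs both in the induction step. The first supplies the hypothesis
  \<open>total\<close> of the window.\<close>

lemma ones_A_B:
  "ones (wordA k) + ones (wordB k) = int (length (wordA k)) \<and>
   2 * ones (wordA k) = int (length (wordA k)) + int (length (wordB k))"
  by (induction k) (auto simp: wordA_0 wordB_0 wordA_Suc wordB_Suc ones_append, simp_all add: ones_def)

lemma wordA_nth: "t < length (wordA k) \<Longrightarrow> wordA k ! t = s t"
  unfolding wordA_def by (rule tau_iter_nth)

lemma tau_iter_tau_iter: "tau_iter k (tau_iter j u) = tau_iter (k + j) u"
  by (simp add: tau_iter_def funpow_add)

section \<open>The sequence as a concatenation of level-\<open>k\<close> blocks\<close>

definition block_start :: "nat \<Rightarrow> nat \<Rightarrow> nat" where
  "block_start k j = length (tau_iter k (map s [0..<j]))"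

lemma map_s_eq_wordA: "map s [0..<length (wordA k)] = wordA k"
  by (rule nth_equalityI) (simp_all add: wordA_nth)

text \<open>A prefix of \<open>s\<close> is a prefix of some \<open>wordA j\<close>, which
  \<open>tau_iter k\<close> maps to \<open>wordA (k + j)\<close>, and the letters of that word are
  again those of \<open>s\<close>.\<close>

lemma tau_iter_prefix: "tau_iter k (map s [0..<j]) = map s [0..<block_start k j]"
proof -
  have j: "j < length (wordA j)" unfolding wordA_def by (rule less_length_tau_iter)
  have "map s [0..<j] @ map s [j..<length (wordA j)] = wordA j"
    using j by (metis less_imp_le_nat map_append map_s_eq_wordA upt_add_eq_append add_0 le_add_diff_inverse le0)
  then have "tau_iter k (map s [0..<j]) @ tau_iter k (map s [j..<length (wordA j)]) = wordA (k + j)"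
    by (simp add: wordA_def tau_iter_tau_iter flip: tau_iter_append)
  then have eq: "tau_iter k (map s [0..<j]) = take (block_start k j) (wordA (k + j))"
    and le: "block_start k j \<le> length (wordA (k + j))"
    by (metis append_eq_conv_conj block_start_def, metis block_start_def le_add1 length_append)
  show ?thesis unfolding eq using le by (intro nth_equalityI) (simp_all add: wordA_nth)
qed

lemma map_s_upt_split: "i \<le> j \<Longrightarrow> map s [0..<j] = map s [0..<i] @ map s [i..<j]"
  by (metis le_add_diff_inverse map_append upt_add_eq_append le0)

lemma block_start_add:
  assumes "i \<le> j"
  shows "block_start k j = block_start k i + length (tau_iter k (map s [i..<j]))"
  unfolding block_start_def map_s_upt_split[OF assms] by (simp add: tau_iter_append)

lemma block_start_Suc:
  "block_start k (Suc j) = block_start k j + (if s j then length (wordA k) else length (wordB k))"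
  using block_start_add[of j "Suc j" k] by (simp add: wordA_def wordB_def)

lemma block_start_0: "block_start k 0 = 0"
  by (induction k) (simp_all add: block_start_def tau_iter_def tau_word_def)

lemma block_start_strict_mono: "strict_mono (block_start k)"
  using length_wordB_bounds[of k] by (auto simp: strict_mono_Suc_iff block_start_Suc)

lemma nth_block:
  assumes "i \<le> j" "t < length (tau_iter k (map s [i..<j]))"
  shows "s (block_start k i + t) = tau_iter k (map s [i..<j]) ! t"
proof -
  have "map s [0..<block_start k j] = map s [0..<block_start k i] @ tau_iter k (map s [i..<j])"
    unfolding tau_iter_prefix[symmetric] map_s_upt_split[OF assms(1)] by (rule tau_iter_append)
  moreover have "map s [0..<block_start k j] ! (block_start k i + t) = s (block_start k i + t)"
    using assms(2) block_start_add[OF assms(1), of k] by simp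
  ultimately show ?thesis by (simp add: nth_append)
qed

lemma block_cover: "\<exists>i. block_start k i \<le> x \<and> x < block_start k (Suc i)"
proof (induction x)
  case 0
  show ?case using block_start_strict_mono[of k] block_start_0[of k]
    by (intro exI[of _ 0]) (metis strict_mono_less lessI le0)
next
  case (Suc x)
  then obtain i where i: "block_start k i \<le> x" "x < block_start k (Suc i)" by blast
  show ?case
  proof (cases "Suc x < block_start k (Suc i)")
    case True
    then show ?thesis using i by (intro exI[of _ i]) simp
  next
    case False
    then have "Suc x = block_start k (Suc i)" using i by simp
    then show ?thesis using strict_mono_less[OF block_start_strict_mono, of k "Suc i" "Suc (Suc i)"]
      by (intro exI[of _ "Suc i"]) simp
  qed
qed

text \<open>Cut into the images \<open>101\<close> and \<open>1\<close> of single letters,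
  \<open>s\<close> has zeros only in the middle of \<open>101\<close>, and the next image begins
  with 1.\<close>

lemma s_after_zero:
  assumes "\<not> s j"
  shows "s (Suc j) \<and> s (Suc (Suc j))"
proof -
  define u where "u i = (if s i then wordA (Suc 0) else wordB (Suc 0))" for i
  have A: "wordA (Suc 0) = [True, False, True]" and B: "wordB (Suc 0) = [True]"
    using wordA_Suc[of 0] wordB_Suc[of 0] by (simp_all add: wordA_0 wordB_0)
  have u: "u i = [True, False, True] \<or> u i = [True]" for i by (simp add: u_def A B)
  have image: "tau_iter (Suc 0) (map s [i..<Suc i]) = u i" for i
    by (simp add: u_def wordA_def wordB_def)
  have nth: "s (block_start (Suc 0) i + t) = u i ! t" if "t < length (u i)" for i t
    using nth_block[of i "Suc i" t "Suc 0"] that unfolding image by simp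
  have start_Suc: "block_start (Suc 0) (Suc i) = block_start (Suc 0) i + length (u i)" for i
    using block_start_add[of i "Suc i" "Suc 0"] unfolding image by simp
  obtain i where i: "block_start (Suc 0) i \<le> j" "j < block_start (Suc 0) (Suc i)"
    using block_cover by blast
  define t where "t = j - block_start (Suc 0) i"
  have t: "j = block_start (Suc 0) i + t" "t < length (u i)"
    using i start_Suc[of i] by (auto simp: t_def)
  have letter: "\<not> u i ! t" using assms nth[OF t(2)] t(1) by simp
  have ui: "u i = [True, False, True]"
  proof (rule ccontr)
    assume "\<not> ?thesis"
    then have "u i = [True]" using u[of i] by blast
    then show False using letter t(2) by simp
  qed
  have "t = 0 \<or> t = 1 \<or> t = 2" using t(2) unfolding ui by auto
  then have "t = 1" using letter unfolding ui by auto
  with ui have j1: "Suc j = block_start (Suc 0) i + 2" and j2: "Suc (Suc j) = block_start (Suc 0) (Suc i) + 0"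
    using t(1) start_Suc[of i] by simp_all
  have "s (Suc j)" unfolding j1 using nth[of 2 i] by (simp add: ui)
  moreover have "s (Suc (Suc j))" unfolding j2 using nth[of 0 "Suc i"] u[of "Suc i"] by auto
  ultimately show ?thesis ..
qed

lemma s_before_zero:
  assumes "\<not> s j"
  shows "0 < j" "s (j - 1)" "2 \<le> j \<Longrightarrow> s (j - 2)"
proof -
  have "s 0" using wordA_nth[of 0 0] by (simp add: wordA_0)
  then show pos: "0 < j" using assms by (cases j) auto
  show "s (j - 1)"
  proof (cases j)
    case (Suc i)
    then show ?thesis using s_after_zero[of i] assms by auto
  qed (use pos in simp)
  show "s (j - 2)" if "2 \<le> j"
  proof -
    define i where "i = j - 2"
    have "j = Suc (Suc i)" using that by (simp add: i_def)
    then show ?thesis using s_after_zero[of i] assms by auto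
  qed
qed

section \<open>The local shape of the sequence around a block \<open>B\<close>\<close>

definition periodicA :: "nat \<Rightarrow> int \<Rightarrow> int" where
  "periodicA k x = of_bool (s (nat (x mod int (length (wordA k)))))"

text \<open>The bi-infinite word \<open>\<dots> A A . B A A \<dots>\<close> with the dot at position 0. It agrees with \<open>s\<close> near every
  block \<open>B\<close>, even where \<open>s\<close> continues with another \<open>B\<close>, since \<open>AB\<close> and \<open>BA\<close> agree up to the middle.\<close>

definition local_word :: "nat \<Rightarrow> int \<Rightarrow> int" where
  "local_word k x = (if x < 0 then periodicA k x
     else if x < int (length (wordB k)) then of_bool (wordB k ! nat x)
     else periodicA k (x - int (length (wordB k))))"

lemma periodicA_periodic: "periodicA k (x + int (length (wordA k))) = periodicA k x"
  by (simp add: periodicA_def)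

lemma periodicA_eq:
  assumes "int (length (wordA k)) dvd x - int t" "t < length (wordA k)"
  shows "periodicA k x = of_bool (wordA k ! t)"
proof -
  have "x mod int (length (wordA k)) = int t mod int (length (wordA k))"
    using assms(1) by (simp add: mod_eq_dvd_iff)
  then show ?thesis using assms(2) by (simp add: periodicA_def wordA_nth)
qed

text \<open>After \<open>B\<close> come two blocks \<open>A\<close> and then \<open>A\<close> or
  \<open>BA\<close>. In the second case \<open>BA\<close> agrees with \<open>AB\<close> before
  position \<open>mid k - 1\<close>, whence the bound on \<open>y\<close>.\<close>

lemma s_local_right:
  assumes "\<not> s j" "y < length (wordB k) + 2 * length (wordA k) + mid k - 1"
  shows "of_bool (s (block_start k j + y)) = local_word k (int y)"
proof -
  let ?A = "wordA k" and ?B = "wordB k"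
  let ?a = "length ?A" and ?b = "length ?B"
  have l: "s (j + 1)" "s (j + 2)" using s_after_zero[OF assms(1)] by simp_all
  have AB: "tau_iter k [True] = ?A" "tau_iter k [False] = ?B" by (simp_all add: wordA_def wordB_def)
  have letters: "[j..<j + 4] = [j, j + 1, j + 2, j + 3]" "[j..<j + 5] = [j, j + 1, j + 2, j + 3, j + 4]"
    by (simp_all add: upt_rec)
  have split: "tau_iter k (x # y # u) = tau_iter k [x] @ tau_iter k (y # u)" for x y u
    using tau_iter_append[of k "[x]" "y # u"] by simp
  have "s (block_start k j + y) = (?B @ ?A @ ?A @ ?A) ! y"
  proof (cases "s (j + 3)")
    case True
    have "tau_iter k (map s [j..<j + 4]) = ?B @ ?A @ ?A @ ?A"
      using assms(1) l True by (simp add: letters split AB)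
    then show ?thesis using nth_block[of j "j + 4" y k] assms(2) mid_bounds[of k] by simp
  next
    case False
    then have "s (j + 4)" using s_after_zero[of "j + 3"] by (simp add: add.commute)
    then have "tau_iter k (map s [j..<j + 5]) = ?B @ ?A @ ?A @ ?B @ ?A"
      using assms(1) l False by (simp add: letters split AB)
    then have eq: "s (block_start k j + y) = (?B @ ?A @ ?A @ ?B @ ?A) ! y"
      using nth_block[of j "j + 5" y k] assms(2) mid_bounds[of k] by simp
    show ?thesis
    proof (cases "y < ?b + 2 * ?a")
      case True
      then show ?thesis unfolding eq by (auto simp: nth_append)
    next
      case False
      then obtain t where t: "y = ?b + ?a + ?a + t" by (metis le_iff_add not_less mult_2 add.assoc)
      then have tm: "t < mid k - 1" "t < ?a" using assms(2) mid_bounds[of k] by linarith+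
      have "(?B @ ?A) ! t = (?A @ ?B) ! t"
        using AB_commute_nth[of t k] tm two_mid[of k] by simp
      then show ?thesis unfolding eq unfolding t using tm by (simp add: nth_append)
    qed
  qed
  moreover have "of_bool ((?B @ ?A @ ?A @ ?A) ! y) = local_word k (int y)"
  proof -
    consider "y < ?b" | "?b \<le> y" "y < ?b + ?a" | "?b + ?a \<le> y" "y < ?b + 2 * ?a" | "?b + 2 * ?a \<le> y" by linarith
    then show ?thesis
    proof cases
      case 1
      then show ?thesis by (simp add: local_word_def nth_append)
    next
      case 2
      then have "periodicA k (int y - int ?b) = of_bool (?A ! (y - ?b))" by (intro periodicA_eq) auto
      then show ?thesis using 2 by (simp add: local_word_def nth_append)
    next
      case 3
      then have "periodicA k (int y - int ?b) = of_bool (?A ! (y - ?b - ?a))" by (intro periodicA_eq) (auto simp: of_nat_diff)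
      then show ?thesis using 3 by (simp add: local_word_def nth_append)
    next
      case 4
      then have "periodicA k (int y - int ?b) = of_bool (?A ! (y - ?b - ?a - ?a))"
        using assms(2) mid_bounds[of k] by (intro periodicA_eq) (auto simp: of_nat_diff)
      then show ?thesis using 4 by (simp add: local_word_def nth_append)
    qed
  qed
  ultimately show ?thesis by simp
qed

text \<open>Among the three blocks before \<open>B\<close> only the farthest can fail to be
  \<open>A\<close>. It is then a \<open>B\<close> preceded by \<open>A\<close>, and
  \<open>AB\<close> agrees with \<open>BA\<close> beyond the middle, so the letters are those of
  \<open>AAA\<close>. Near the beginning of \<open>s\<close> there are fewer blocks, and
  \<open>y \<le> block_start k j\<close> limits the range.\<close>

lemma s_local_left:
  assumes "\<not> s j" "0 < y" "y < 2 * length (wordA k) + mid k" "y \<le> block_start k j"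
  shows "of_bool (s (block_start k j - y)) = local_word k (- int y)"
proof -
  let ?A = "wordA k" and ?B = "wordB k"
  let ?a = "length ?A" and ?b = "length ?B"
  have AB: "tau_iter k [True] = ?A" "tau_iter k [False] = ?B" by (simp_all add: wordA_def wordB_def)
  have split: "tau_iter k (x # y # u) = tau_iter k [x] @ tau_iter k (y # u)" for x y u
    using tau_iter_append[of k "[x]" "y # u"] by simp
  have step_back: "s (block_start k j - y) = tau_iter k (map s [i..<j]) ! (length (tau_iter k (map s [i..<j])) - y)"
    if "i \<le> j" "y \<le> length (tau_iter k (map s [i..<j]))" for i
    using nth_block[of i j "length (tau_iter k (map s [i..<j])) - y" k] block_start_add[of i j k] that assms(2)
    by (simp add: Nat.add_diff_assoc)
  have periodicA: "local_word k (- int y) = of_bool (?A ! t)" if "t < ?a" "int t = int c * int ?a - int y" for t c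
  proof -
    have "- int y - int t = int ?a * (- int c)" using that by simp
    then have "periodicA k (- int y) = of_bool (?A ! t)" using that(1) by (intro periodicA_eq) (auto intro: dvdI)
    then show ?thesis using assms(2) by (simp add: local_word_def)
  qed
  have j: "0 < j" "s (j - 1)" "2 \<le> j \<Longrightarrow> s (j - 2)" using s_before_zero[OF assms(1)] by auto
  have three: "?thesis" if "y \<le> 3 * ?a" "s (block_start k j - y) = (?A @ ?A @ ?A) ! (3 * ?a - y)"
  proof -
    consider "y \<le> ?a" | "?a < y" "y \<le> 2 * ?a" | "2 * ?a < y" by linarith
    then show ?thesis
    proof cases
      case 1
      then show ?thesis using that assms(2) periodicA[of "?a - y" 1] by (simp add: nth_append of_nat_diff)
    next
      case 2
      then have "3 * ?a - y - ?a = 2 * ?a - y" by simp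
      then show ?thesis using that 2 periodicA[of "2 * ?a - y" 2] by (simp add: nth_append of_nat_diff)
    next
      case 3
      then show ?thesis using that periodicA[of "3 * ?a - y" 3] by (simp add: nth_append of_nat_diff)
    qed
  qed
  consider "j = 1" | "j = 2" | "3 \<le> j" "s (j - 3)" | "3 \<le> j" "\<not> s (j - 3)"
    using j(1) by (cases "s (j - 3)") linarith+
  then show ?thesis
  proof cases
    case 1
    then have "y \<le> ?a" using assms(4) j block_start_Suc[of k 0] by (simp add: block_start_0)
    moreover have "tau_iter k (map s [0..<j]) = ?A" using 1 j by (simp add: AB)
    ultimately have "s (block_start k j - y) = ?A ! (?a - y)" using step_back[of 0] by simp
    then show ?thesis using periodicA[of "?a - y" 1] \<open>y \<le> ?a\<close> assms(2) by (simp add: of_nat_diff)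
  next
    case 2
    then have "s 0" "s 1" using j by auto
    then have "tau_iter k (map s [0..<j]) = ?A @ ?A" using 2 by (simp add: AB split numeral_2_eq_2)
    moreover from this have "y \<le> 2 * ?a" using assms(4) by (simp add: block_start_def)
    ultimately have "s (block_start k j - y) = (?A @ ?A) ! (2 * ?a - y)" using step_back[of 0] by (simp add: mult_2)
    moreover have "3 * ?a - y = ?a + (2 * ?a - y)" using \<open>y \<le> 2 * ?a\<close> by simp
    then have "(?A @ ?A @ ?A) ! (3 * ?a - y) = (?A @ ?A) ! (2 * ?a - y)"
      by (simp only: nth_append_length_plus)
    ultimately have "s (block_start k j - y) = (?A @ ?A @ ?A) ! (3 * ?a - y)" by (simp only:)
    moreover have "y \<le> 3 * ?a" using \<open>y \<le> 2 * ?a\<close> by simp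
    ultimately show ?thesis by (intro three)
  next
    case 3
    then obtain i where i: "j = i + 3" by (metis le_add_diff_inverse2)
    have "[i..<i + 3] = [i, i + 1, i + 2]" by (simp add: upt_rec)
    then have "[j - 3..<j] = [j - 3, j - 2, j - 1]" by (simp add: i)
    then have "tau_iter k (map s [j - 3..<j]) = ?A @ ?A @ ?A" using 3 j by (simp add: AB split)
    moreover have triple: "?a + (?a + ?a) = 3 * ?a" by simp
    moreover have y: "y \<le> 3 * ?a" using assms(3) mid_bounds[of k] by simp
    ultimately have "s (block_start k j - y) = (?A @ ?A @ ?A) ! (3 * ?a - y)"
      using step_back[of "j - 3"] by (simp add: triple)
    then show ?thesis by (intro three y)
  next
    case 4
    then have j4: "4 \<le> j" "s (j - 4)" using s_before_zero[of "j - 3"] by (auto simp: diff_diff_left)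
    then obtain i where i: "j = i + 4" by (metis le_add_diff_inverse2)
    have "[i..<i + 4] = [i, i + 1, i + 2, i + 3]" by (simp add: upt_rec)
    then have "[j - 4..<j] = [j - 4, j - 3, j - 2, j - 1]" by (simp add: i)
    then have w: "tau_iter k (map s [j - 4..<j]) = ?A @ ?B @ ?A @ ?A" using 4 j4 j by (simp add: AB split)
    then have eq: "s (block_start k j - y) = (?A @ ?B @ ?A @ ?A) ! (3 * ?a + ?b - y)"
      using step_back[of "j - 4"] assms(3) mid_bounds[of k] by (simp add: numeral_3_eq_3 ac_simps)
    have "(?A @ ?B @ ?A @ ?A) ! (3 * ?a + ?b - y) = (?A @ ?A @ ?A) ! (3 * ?a - y)"
    proof (cases "y \<le> 2 * ?a")
      case True
      then have "3 * ?a + ?b - y = ?a + ?b + (2 * ?a - y)" "3 * ?a - y = ?a + (2 * ?a - y)" by simp_all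
      then show ?thesis by (simp add: nth_append)
    next
      case False
      \<comment> \<open>This is the position in \<open>ABAA\<close> counted from the left; the bound
        on \<open>y\<close> puts it beyond \<open>mid k\<close>.\<close>
      define p where "p = 3 * ?a + ?b - y"
      have p: "mid k < p" "p < 2 * mid k" "?b \<le> p" "3 * ?a - y = p - ?b" "p - ?b < ?a"
        using False assms(3) two_mid[of k] mid_bounds[of k] by (auto simp: p_def)
      have "(?A @ ?B @ ?A @ ?A) ! p = (?A @ ?B) ! p"
        using p two_mid[of k] by (auto simp: nth_append)
      also have "\<dots> = (?B @ ?A) ! p"
        using AB_commute_nth[of p k] p by simp
      also have "\<dots> = (?A @ ?A @ ?A) ! (p - ?b)" using p by (simp add: nth_append)
      finally show ?thesis unfolding p(4) p_def .
    qed
    then have "s (block_start k j - y) = (?A @ ?A @ ?A) ! (3 * ?a - y)" by (simp only: eq)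
    moreover have "y \<le> 3 * ?a" using assms(3) mid_bounds[of k] by simp
    ultimately show ?thesis by (intro three)
  qed
qed

lemma s_local:
  assumes "\<not> s j" "- int (2 * length (wordA k) + mid k) < x"
    "x < int (length (wordB k) + 2 * length (wordA k) + mid k) - 1" "0 \<le> int (block_start k j) + x"
  shows "of_bool (s (nat (int (block_start k j) + x))) = local_word k x"
proof (cases "x < 0")
  case True
  then obtain y where "x = - int y" "0 < y" by (metis neg_less_0_iff_less of_nat_0_less_iff zero_less_imp_eq_int minus_minus)
  then show ?thesis using s_local_left[OF assms(1), of y k] assms by (simp add: nat_diff_distrib' flip: of_nat_diff)
next
  case False
  then obtain y where "x = int y" by (metis zero_le_imp_eq_int not_less)
  then show ?thesis using s_local_right[OF assms(1), of y k] assms by (simp add: nat_int_add)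
qed

text \<open>Modulo \<open>a\<close>, delaying by \<open>b\<close> compares \<open>BA\<close> with
  \<open>AB\<close> letter by letter. Positions \<open>y < b\<close> wrap around and use the
  comparison twice, at \<open>y\<close> and at \<open>y + a\<close>.\<close>

lemma periodicA_shift_diff:
  "periodicA k (x - int (length (wordB k))) - periodicA k x =
    (-1) ^ mid k * (ind (length (wordA k)) (x - int (mid k) + 1) - ind (length (wordA k)) (x - int (mid k)))"
proof -
  let ?A = "wordA k" and ?B = "wordB k"
  let ?a = "length ?A" and ?b = "length ?B"
  have a0: "0 < ?a" using odd_length_wordA odd_pos by blast
  note mb = mid_bounds[of k] and tm = two_mid[of k] and lb = length_wordB_bounds[of k]
  let ?F = "\<lambda>x. periodicA k (x - int ?b) - periodicA k x - (-1) ^ mid k * (ind ?a (x - int (mid k) + 1) - ind ?a (x - int (mid k)))"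
  have F_periodic: "?F (x + int ?a) = ?F x" for x
    using periodicA_periodic[of k x] periodicA_periodic[of k "x - int ?b"] ind_periodic[of ?a "x - int (mid k) + 1"]
      ind_periodic[of ?a "x - int (mid k)"] by (simp add: algebra_simps)
  have F_nat: "?F (int y) = 0" if y: "y < ?a" for y
  proof -
    have i1: "ind ?a (int y - int (mid k) + 1) = of_bool (y = mid k - 1)"
    proof -
      have "int ?a dvd int y - int (mid k) + 1 \<longleftrightarrow> y = mid k - 1"
      proof
        assume "int ?a dvd int y - int (mid k) + 1"
        then have "int ?a dvd int y - int (mid k - 1)" using mb(1) by (simp add: of_nat_diff algebra_simps)
        then have "[y = mid k - 1] (mod ?a)" using cong_int_iff[of y "mid k - 1" ?a] by (simp add: cong_iff_dvd_diff)
        then show "y = mid k - 1" using y mb by (simp add: cong_def)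
      qed (use mb in auto)
      then show ?thesis by (simp add: ind_def)
    qed
    \<comment> \<open>The second alternative occurs only for \<open>mid k = a\<close> and
      \<open>y = 0\<close>, since \<open>mid k \<le> a\<close>.\<close>
    have i2: "ind ?a (int y - int (mid k)) = of_bool (y = mid k) + of_bool (y + ?a = mid k)"
    proof -
      have "int ?a dvd int y - int (mid k) \<longleftrightarrow> y = mid k \<or> y + ?a = mid k"
      proof
        assume "int ?a dvd int y - int (mid k)"
        then have "y mod ?a = mid k mod ?a"
          using cong_int_iff[of y "mid k" ?a] by (simp add: cong_iff_dvd_diff cong_def)
        then show "y = mid k \<or> y + ?a = mid k" using y mb(1,2) by (cases "mid k = ?a") auto
      next
        assume "y = mid k \<or> y + ?a = mid k"
        then have "int y - int (mid k) = 0 \<or> int y - int (mid k) = - int ?a" by linarith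
        then show "int ?a dvd int y - int (mid k)" by auto
      qed
      then show ?thesis using a0 by (auto simp: ind_def)
    qed
    have v: "periodicA k (int y) = of_bool (?A ! y)" using y by (intro periodicA_eq) auto
    show ?thesis
    proof (cases "?b \<le> y")
      case True
      then have "periodicA k (int y - int ?b) = of_bool (?A ! (y - ?b))" using y by (intro periodicA_eq) auto
      moreover have "y + ?a \<noteq> mid k" using True mb lb by linarith
      ultimately show ?thesis using AB_commute_up_to_swap[of y k] True y tm v i1 i2
        by (simp add: nth_append)
    next
      case False
      then have "periodicA k (int y - int ?b) = of_bool (?A ! (y + ?a - ?b))" using y lb by (intro periodicA_eq) (auto simp: of_nat_diff)
      moreover have "y + ?a \<noteq> mid k - 1" using mb by linarith
      moreover have "\<not> y + ?a < ?b" using lb by linarith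
      ultimately show ?thesis
        using AB_commute_up_to_swap[of y k] AB_commute_up_to_swap[of "y + ?a" k] False y tm v i1 i2 lb
        by (simp add: nth_append algebra_simps)
    qed
  qed
  have "?F x = ?F (int (nat (x mod int ?a)))"
    using periodic_dvd_cong[of ?F ?a x "int (nat (x mod int ?a))"] F_periodic a0 by simp
  also have "\<dots> = 0" by (rule F_nat) (use a0 in \<open>simp add: nat_less_iff\<close>)
  finally show ?thesis by simp
qed

text \<open>From position 0 on the local word reads \<open>BA\<close> and the periodic word
  \<open>AB\<close>; up to \<open>mid k - 1\<close> only the first of the two swapped letters
  shows.\<close>

lemma local_word_left:
  assumes "x \<le> int (mid k) - 1"
  shows "local_word k x = periodicA k x + (-1) ^ mid k * of_bool (x = int (mid k) - 1)"
proof (cases "x < 0")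
  case True
  then show ?thesis using mid_bounds(1)[of k] by (simp add: local_word_def)
next
  case False
  then obtain y where x: "x = int y" by (metis zero_le_imp_eq_int not_less)
  have y: "y < mid k" using assms x by linarith
  let ?A = "wordA k" and ?B = "wordB k"
  note mb = mid_bounds[of k] and tm = two_mid[of k]
  have "local_word k x = of_bool ((?B @ ?A) ! y)"
  proof (cases "y < length ?B")
    case False
    then have "periodicA k (int y - int (length ?B)) = of_bool (?A ! (y - length ?B))"
      using y mb by (intro periodicA_eq) auto
    then show ?thesis using False by (simp add: local_word_def x nth_append)
  qed (simp add: local_word_def x nth_append)
  moreover have "periodicA k x = of_bool ((?A @ ?B) ! y)"
    using periodicA_eq[of k x y] x y mb by (simp add: nth_append)
  moreover have "(x = int (mid k) - 1) = (y = mid k - 1)" using x mb(1) by auto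
  ultimately show ?thesis using AB_commute_up_to_swap[of y k] y by simp
qed

text \<open>For \<open>x < b\<close> the letter is that of \<open>AB\<close> at
  \<open>x + a\<close>, a position beyond the middle, so it may be read off \<open>BA\<close>
  instead.\<close>

lemma local_word_right:
  assumes "int (mid k) - int (length (wordA k)) + 1 \<le> x"
  shows "local_word k x = periodicA k (x - int (length (wordB k)))"
proof (cases "x < int (length (wordB k))")
  case False
  then show ?thesis by (simp add: local_word_def)
next
  case True
  let ?A = "wordA k" and ?B = "wordB k"
  note mb = mid_bounds[of k] and tm = two_mid[of k]
  define y where "y = nat (x + int (length ?A))"
  have x: "x = int y - int (length ?A)" using assms mb by (simp add: y_def)
  have y: "mid k < y" "y < 2 * mid k" "length ?B \<le> y" "y - length ?B < length ?A"
    using assms True x tm mb by linarith+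
  have "local_word k x = of_bool ((?A @ ?B) ! y)"
  proof (cases "x < 0")
    case True
    then have "periodicA k x = of_bool (?A ! y)" using x by (intro periodicA_eq) auto
    then show ?thesis using True x by (simp add: local_word_def nth_append)
  next
    case False
    then show ?thesis using \<open>x < int (length ?B)\<close> x by (simp add: local_word_def nth_append nat_diff_distrib')
  qed
  also have "\<dots> = of_bool ((?B @ ?A) ! y)"
    using AB_commute_nth[of y k] y by simp
  also have "\<dots> = periodicA k (x - int (length ?B))"
    using periodicA_eq[of k "x - int (length ?B)" "y - length ?B"] y x by (simp add: nth_append of_nat_diff)
  finally show ?thesis .
qed

lemma local_word_total:
  "(\<Sum>t<length (wordA k). periodicA k (int t)) + (\<Sum>t<length (wordB k). local_word k (int t)) = int (length (wordA k))"
proof -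
  have "(\<Sum>t<length (wordA k). periodicA k (int t)) = ones (wordA k)"
    unfolding ones_conv_sum by (intro sum.cong refl periodicA_eq) auto
  moreover have "(\<Sum>t<length (wordB k). local_word k (int t)) = ones (wordB k)"
    unfolding ones_conv_sum by (intro sum.cong refl) (simp add: local_word_def)
  ultimately show ?thesis using ones_A_B[of k] by simp
qed

subsection \<open>Numeration and block positions\<close>

definition psum :: "(nat \<Rightarrow> nat) \<Rightarrow> nat \<Rightarrow> nat" where
  "psum a J = (\<Sum>i<J. a i * flen i)"

lemma psum_0: "psum a 0 = 0" and psum_Suc: "psum a (Suc J) = psum a J + a J * flen J"
  by (simp_all add: psum_def)

lemma psum_cong: "(\<And>i. i < J \<Longrightarrow> a i = b i) \<Longrightarrow> psum a J = psum b J"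
  by (simp add: psum_def)

lemma psum_split:
  assumes "I \<le> J" "\<And>i. I \<le> i \<Longrightarrow> i < J \<Longrightarrow> a i = 0"
  shows "psum a J = psum a I"
  unfolding psum_def using assms by (intro sum.mono_neutral_right) auto

lemma value_eq_psum:
  assumes "\<And>i. J \<le> i \<Longrightarrow> a i = 0"
  shows "(\<Sum>i | a i \<noteq> 0. a i * flen i) = psum a J"
proof -
  have "i < J" if "a i \<noteq> 0" for i using assms[of i] that by (cases "i < J") auto
  then show ?thesis unfolding psum_def by (intro sum.mono_neutral_left) auto
qed

lemma flen_step: "flen (Suc (2 * k)) = flen (2 * k) + length (wordB k)"
  using length_AB[of k] by (simp add: length_wordA)

lemma flen_pos: "0 < flen i"
proof (cases "even i")
  case True
  then obtain k where "i = 2 * k" by (elim evenE)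
  then show ?thesis using odd_pos[OF odd_length_wordA[of k]] by (simp add: length_wordA)
next
  case False
  then obtain k where k: "i = 2 * k + 1" by (elim oddE)
  show ?thesis unfolding k length_AB[symmetric] using length_wordB_bounds[of k] by simp
qed

lemma flen_less_Suc: "flen i < flen (Suc i)"
proof (cases "even i")
  case True
  then show ?thesis using length_wordB_bounds by (auto elim!: evenE simp: flen_step)
next
  case False
  then obtain k where "i = 2 * k + 1" by (elim oddE)
  then show ?thesis using flen_rec_even[of k] flen_pos[of "2 * k"] by simp
qed

lemma flen_strict_mono: "strict_mono flen"
  using flen_less_Suc by (simp add: strict_mono_Suc_iff)

lemma less_flen: "i < flen i"
proof (induction i)
  case 0
  show ?case by (rule flen_pos)
next
  case (Suc i)
  then show ?case using flen_less_Suc[of i] by simp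
qed

lemma admissible_bit: "admissible a \<Longrightarrow> a i = 0 \<or> a i = 1"
  by (auto simp: admissible_def)

lemma admissible_next:
  assumes "admissible a" "a i = 1"
  shows "a (Suc i) = 0"
proof -
  have "a i * a (i + 1) = 0" using assms(1) unfolding admissible_def by blast
  then show ?thesis using assms(2) by simp
qed

lemma admissible_next2:
  assumes "admissible a" "a i = 1" "even i"
  shows "a (i + 2) = 0"
proof -
  have "a i * a (i + 2) = 0" using assms(1,3) unfolding admissible_def by blast
  then show ?thesis using assms(2) by simp
qed

lemma admissible_prev: "admissible a \<Longrightarrow> a (Suc i) = 1 \<Longrightarrow> a i = 0"
  using admissible_next[of a i] admissible_bit[of a i] by auto

lemma admissible_prev2: "admissible a \<Longrightarrow> a (i + 2) = 1 \<Longrightarrow> even i \<Longrightarrow> a i = 0"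
  using admissible_next2[of a i] admissible_bit[of a i] by auto

lemma admissibleI:
  assumes "\<And>i. a i = 0 \<or> a i = 1" "\<And>i. J \<le> i \<Longrightarrow> a i = 0"
    "\<And>i. a i = 1 \<Longrightarrow> a (Suc i) = 1 \<Longrightarrow> False" "\<And>i. even i \<Longrightarrow> a i = 1 \<Longrightarrow> a (i + 2) = 1 \<Longrightarrow> False"
  shows "admissible a"
proof -
  have "i < J" if "a i \<noteq> 0" for i using assms(2)[of i] that by (cases "i < J") auto
  then have "{i. a i \<noteq> 0} \<subseteq> {..<J}" by auto
  then have "finite {i. a i \<noteq> 0}" by (rule finite_subset) simp
  moreover have "a i * a (i + 1) = 0" for i
    using assms(3)[of i] assms(1)[of i] assms(1)[of "i + 1"] by auto
  moreover have "a i * a (i + 2) = 0" if "even i" for i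
    using assms(4)[OF that] assms(1)[of i] assms(1)[of "i + 2"] by auto
  moreover have "a i \<in> {0, 1}" for i using assms(1)[of i] by simp
  then have "range a \<subseteq> {0, 1}" by (rule image_subsetI)
  ultimately show ?thesis unfolding admissible_def by blast
qed

lemma admissible_bounded:
  assumes "admissible a"
  shows "\<exists>J. \<forall>i\<ge>J. a i = 0"
proof -
  have "finite {i. a i \<noteq> 0}" using assms by (simp add: admissible_def)
  then obtain J where "\<forall>i\<in>{i. a i \<noteq> 0}. i < J" using finite_nat_set_iff_bounded by blast
  then have "\<forall>i\<ge>J. a i = 0" using not_le by blast
  then show ?thesis ..
qed

lemma parity_cases: "(i :: nat) = 0 \<or> (\<exists>k. i = 2 * k + 1) \<or> (\<exists>k. i = 2 * k + 2)"
  by presburger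

text \<open>A top digit 1 at \<open>2 * k + 1\<close> excludes the digit at \<open>2 * k\<close>,
  and one at \<open>2 * k + 2\<close> excludes those at \<open>2 * k + 1\<close> and
  \<open>2 * k\<close>. In both cases the recurrence leaves exactly \<open>flen (2 * k)\<close> as
  bound for the rest.\<close>

lemma psum_less:
  assumes "admissible a"
  shows "psum a J < flen J"
proof (induction J rule: less_induct)
  case (less J)
  show ?case
  proof (cases J)
    case 0
    then show ?thesis using flen_pos by (simp add: psum_0)
  next
    case (Suc I)
    show ?thesis
    proof (cases "a I = 0")
      case True
      then show ?thesis using Suc less[of I] flen_less_Suc[of I] by (simp add: psum_Suc)
    next
      case False
      then have aI: "a I = 1" using admissible_bit[OF assms, of I] by auto
      consider k where "I = 2 * k + 1" | "I = 0" | k where "I = 2 * k + 2"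
        using parity_cases[of I] by blast
      then show ?thesis
      proof cases
        case (1 k)
        then have "a (2 * k) = 0" using admissible_prev[OF assms, of "2 * k"] aI by simp
        then show ?thesis using less[of "2 * k"] Suc 1 aI flen_rec_even[of k] by (simp add: psum_Suc)
      next
        case 2
        then show ?thesis using Suc aI flen_0 flen_1 by (simp add: psum_Suc psum_0)
      next
        case (3 k)
        then have "a (2 * k + 1) = 0" "a (2 * k) = 0"
          using admissible_prev[OF assms, of "2 * k + 1"] admissible_prev2[OF assms, of "2 * k"] aI by simp_all
        then have "psum a J = psum a (2 * k) + flen (2 * k + 2)"
          using Suc 3 aI by (simp add: psum_Suc)
        moreover have "flen J = flen (2 * k) + flen (2 * k + 2)"
          using flen_rec_odd[of k] Suc 3 by (simp add: numeral_3_eq_3)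
        ultimately show ?thesis using less[of "2 * k"] Suc 3 by simp
      qed
    qed
  qed
qed

lemma psum_unique:
  assumes "admissible a" "admissible b" "psum a J = psum b J" "i < J"
  shows "a i = b i"
  using assms(3,4)
proof (induction J)
  case (Suc J)
  have eq: "a J = b J"
  proof (rule ccontr)
    assume "a J \<noteq> b J"
    then have "a J = 1 \<and> b J = 0 \<or> a J = 0 \<and> b J = 1"
      using admissible_bit[OF assms(1), of J] admissible_bit[OF assms(2), of J] by auto
    then show False using Suc.prems(1) psum_less[OF assms(1), of J] psum_less[OF assms(2), of J]
      by (auto simp: psum_Suc)
  qed
  then show ?case using Suc by (auto simp: psum_Suc less_Suc_eq)
qed simp

text \<open>A digit at an odd \<open>I\<close> conflicts only with its neighbours, one at an even
  \<open>I\<close> also with \<open>I - 2\<close>; hence the parity-dependent gap.\<close>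

lemma admissible_insert:
  assumes "admissible a" "\<And>i. J \<le> i \<Longrightarrow> a i = 0" "J < I" "even I \<Longrightarrow> Suc J < I"
  shows "admissible (a(I := 1))"
proof (rule admissibleI[of _ "Suc I"])
  fix i
  show "(a(I := 1)) i = 0 \<or> (a(I := 1)) i = 1" using admissible_bit[OF assms(1)] by auto
  show "(a(I := 1)) i = 0" if "Suc I \<le> i" using that assms(2,3) by auto
  show False if "(a(I := 1)) i = 1" "(a(I := 1)) (Suc i) = 1"
    using that admissible_next[OF assms(1), of i] assms(2)[of i] assms(2)[of "Suc i"] assms(3)
    by (auto split: if_splits)
  show False if "even i" "(a(I := 1)) i = 1" "(a(I := 1)) (i + 2) = 1"
  proof (cases "i = I \<or> i + 2 = I")
    case True
    then have "even I" using that(1) by auto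
    then show False using True that assms(2)[of i] assms(2)[of "i + 2"] assms(3,4) by (auto split: if_splits)
  next
    case False
    then show False using that admissible_next2[OF assms(1), of i] by auto
  qed
qed

lemma admissible_0: "admissible (\<lambda>_. 0)"
  by (simp add: admissible_def)

lemma digits_exist_bounded:
  "n < flen J \<Longrightarrow> \<exists>a. admissible a \<and> (\<forall>i\<ge>J. a i = 0) \<and> psum a J = n"
proof (induction J arbitrary: n rule: less_induct)
  case (less J)
  show ?case
  proof (cases J)
    case 0
    have "n = 0" using less.prems unfolding 0 flen_0 by simp
    then have "psum (\<lambda>_. 0) J = n" unfolding 0 by (simp only: psum_0)
    then show ?thesis using admissible_0 by blast
  next
    case (Suc I)
    show ?thesis
    proof (cases "n < flen I")
      case True
      then obtain a where "admissible a" "\<forall>i\<ge>I. a i = 0" "psum a I = n" using less.IH[of I] Suc by auto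
      then show ?thesis using Suc by (intro exI[of _ a]) (simp add: psum_Suc)
    next
      case False
      define r where "r = n - flen I"
      have n: "n = flen I + r" using False by (simp add: r_def)
      \<comment> \<open>Greedy choice: after removal of \<open>flen I\<close> the remainder is below
        \<open>flen (2 * k)\<close>, so the other digits sit below \<open>2 * k\<close>, far enough
        from \<open>I\<close> in either parity.\<close>
      have "\<exists>K<I. r < flen K \<and> (even I \<longrightarrow> Suc K < I)" if I0: "I \<noteq> 0"
      proof (cases "even I")
        case False
        then obtain k where k: "I = 2 * k + 1" by (elim oddE)
        have "flen J = flen (2 * k) + flen I" using flen_rec_even[of k] by (simp add: Suc k)
        then have "r < flen (2 * k)" using less.prems n by linarith
        then show ?thesis using k by (intro exI[of _ "2 * k"]) simp
      next
        case True
        then obtain k where k: "I = 2 * k + 2" using I0 parity_cases[of I] by auto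
        have "flen J = flen (2 * k) + flen I" using flen_rec_odd[of k] by (simp add: Suc k numeral_3_eq_3)
        then have "r < flen (2 * k)" using less.prems n by linarith
        then show ?thesis using k by (intro exI[of _ "2 * k"]) simp
      qed
      then have "I = 0 \<or> (\<exists>K<I. r < flen K \<and> (even I \<longrightarrow> Suc K < I))" by blast
      then show ?thesis
      proof (elim disjE exE conjE)
        assume I: "I = 0"
        have "flen J = 2" unfolding Suc I using flen_1 by simp
        then have "n = 1" using n less.prems I flen_0 by simp
        define e where "e = (\<lambda>_ :: nat. 0 :: nat)(0 := 1)"
        have "admissible e" by (rule admissibleI[of _ 1]) (auto simp: e_def split: if_splits)
        moreover have "psum e J = n" unfolding Suc I psum_Suc psum_0 flen_0 \<open>n = 1\<close> by (simp add: e_def)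
        moreover have "\<forall>i\<ge>J. e i = 0" by (simp add: e_def Suc)
        ultimately show ?thesis by (intro exI[of _ e] conjI)
      next
        fix K assume K: "K < I" "r < flen K" "even I \<longrightarrow> Suc K < I"
        have "K < J" using K(1) Suc by simp
        then obtain a where a: "admissible a" "\<forall>i\<ge>K. a i = 0" "psum a K = r"
          using less.IH[OF \<open>K < J\<close> K(2)] by blast
        have "admissible (a(I := 1))"
          by (rule admissible_insert[OF a(1), of K]) (use a(2) K in auto)
        moreover have "psum (a(I := 1)) I = psum a I" by (rule psum_cong) simp
        moreover have "psum a I = r" using psum_split[of K I a] a(2,3) K(1) by simp
        ultimately have "psum (a(I := 1)) J = n" unfolding Suc psum_Suc n by simp
        moreover have "\<forall>i\<ge>J. (a(I := 1)) i = 0" using a(2) K(1) Suc by simp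
        ultimately show ?thesis using \<open>admissible (a(I := 1))\<close> by (intro exI[of _ "a(I := 1)"] conjI)
      qed
    qed
  qed
qed

lemma digits_eqI:
  assumes "admissible a" "\<And>i. J \<le> i \<Longrightarrow> a i = 0" "psum a J = n"
  shows "digits n = a"
  unfolding digits_def
proof (rule the_equality)
  show "admissible a \<and> n = (\<Sum>i | a i \<noteq> 0. a i * flen i)"
    using assms value_eq_psum[of J a] by simp
next
  fix b assume b: "admissible b \<and> n = (\<Sum>i | b i \<noteq> 0. b i * flen i)"
  then obtain L where L: "\<forall>i\<ge>L. b i = 0" using admissible_bounded by blast
  let ?M = "max J L"
  have "psum b ?M = n" using b value_eq_psum[of ?M b] L by simp
  moreover have "psum a ?M = n" using assms psum_split[of J ?M a] by simp
  ultimately have "b i = a i" if "i < ?M" for i using psum_unique[of b a ?M i] b assms(1) that by simp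
  moreover have "b i = a i" if "?M \<le> i" for i using that L assms(2) by simp
  ultimately show "b = a" by (metis ext not_le)
qed

lemma digits_properties:
  assumes "n < flen J"
  shows "admissible (digits n)" "J \<le> i \<Longrightarrow> digits n i = 0" "psum (digits n) J = n"
proof -
  obtain a where a: "admissible a" "\<forall>i\<ge>J. a i = 0" "psum a J = n" using digits_exist_bounded[OF assms] by blast
  then have "digits n = a" by (intro digits_eqI) auto
  then show "admissible (digits n)" "J \<le> i \<Longrightarrow> digits n i = 0" "psum (digits n) J = n" using a by auto
qed

lemma Phi_eq_psum: "Phi k n = psum (digits n) (2 * k + 3)"
proof -
  have "{..2 * k + 2} = {..<2 * k + 3}" by auto
  then show ?thesis by (simp add: Phi_def psum_def)
qed

section \<open>Self-similarity at the lengths \<open>flen\<close> and the positions of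
  blocks\<close>

definition word :: "nat \<Rightarrow> bool list" where
  "word i = tau_iter (i div 2) (if even i then [True] else [True, False])"

lemma length_word: "length (word i) = flen i"
  by (simp add: word_def flen_def)

lemma word_even: "word (2 * k) = wordA k" and word_odd: "word (2 * k + 1) = wordA k @ wordB k"
  using tau_iter_append[of k "[True]" "[False]"] by (simp_all add: word_def wordA_def wordB_def)

lemma tau_iter_word: "tau_iter k (word i) = word (i + 2 * k)"
  by (simp add: word_def tau_iter_tau_iter add.commute)

lemma map_s_word: "map s [0..<flen i] = word i"
proof (cases "even i")
  case True
  then obtain k where "i = 2 * k" by (elim evenE)
  then show ?thesis using map_s_eq_wordA[of k] by (simp add: word_even length_wordA)
next
  case False
  then obtain k where k: "i = 2 * k + 1" by (elim oddE)
  have "s x = (wordA k @ wordB k) ! x" if "x < flen (2 * k + 1)" for x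
  proof -
    have "s x = wordA (Suc k) ! x"
      using that length_AB[of k] by (intro wordA_nth[symmetric]) (simp add: wordA_Suc)
    also have "\<dots> = (wordA k @ wordB k) ! x"
      using that length_AB[of k] nth_append[of "wordA k @ wordB k" "wordA k" x] by (simp add: wordA_Suc)
    finally show ?thesis .
  qed
  then show ?thesis unfolding k word_odd
    by (intro nth_equalityI) (use length_AB[of k] in simp_all)
qed

lemma flen_diff:
  assumes "0 < i"
  shows "flen (Suc i) = flen i + flen (if odd i then i - 1 else i - 2)"
proof (cases "odd i")
  case True
  then obtain k where "i = 2 * k + 1" by (elim oddE)
  then show ?thesis using flen_rec_even[of k] by simp
next
  case False
  then obtain k where "i = 2 * k + 2" using assms parity_cases[of i] by auto
  then show ?thesis using flen_rec_odd[of k] by (simp add: numeral_3_eq_3)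
qed

text \<open>For odd \<open>i\<close> the prefix of length \<open>flen i\<close> is
  \<open>AB\<close>, followed by \<open>A\<close>. For even \<open>i\<close> it is some
  \<open>wordA (Suc k)\<close>, followed by \<open>wordB (Suc k) = wordA k\<close>. Either way
  another prefix of \<open>s\<close> follows.\<close>

lemma s_flen_add:
  assumes "0 < i" "r < flen (Suc i) - flen i"
  shows "s (flen i + r) = s r"
proof (cases "odd i")
  case True
  then obtain k where i: "i = 2 * k + 1" by (elim oddE)
  have r: "r < length (wordA k)" using assms(2) flen_rec_even[of k] by (simp add: i length_wordA)
  have len: "flen i = length (wordA k @ wordB k)" using length_AB[of k] by (simp add: i)
  have "s (flen i + r) = wordA (Suc k) ! (flen i + r)"
    using r len by (intro wordA_nth[symmetric]) (simp add: wordA_Suc)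
  also have "\<dots> = wordA k ! r"
    using nth_append_length_plus[of "wordA k @ wordB k" "wordA k" r] by (simp add: wordA_Suc len)
  finally show ?thesis using wordA_nth[OF r] by simp
next
  case False
  then obtain k where i: "i = 2 * Suc k" using assms(1) parity_cases[of i] by auto
  have r: "r < length (wordB (Suc k))" using assms(2) unfolding i flen_step by (simp only: diff_add_inverse)
  have "s (flen i + r) = wordA (Suc (Suc k)) ! (length (wordA (Suc k)) + r)"
    unfolding i length_wordA[symmetric] using r
    by (intro wordA_nth[symmetric]) (simp add: wordA_Suc[of "Suc k"])
  also have "\<dots> = wordB (Suc k) ! r"
    unfolding wordA_Suc[of "Suc k"] nth_append_length_plus using r by (simp add: nth_append)
  finally show ?thesis using r wordA_nth[of r k] by (simp add: wordB_Suc)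
qed

text \<open>Passing from block indices to block positions moves the numeration by
  \<open>2 * k\<close> places: \<open>flen i\<close> becomes
  \<open>flen (i + 2 * k)\<close>.\<close>

lemma block_start_flen_add:
  assumes "0 < i" "r \<le> flen (Suc i) - flen i"
  shows "block_start k (flen i + r) = flen (i + 2 * k) + block_start k r"
proof -
  have "map s [flen i..<flen i + r] = map s [0..<r]"
    using s_flen_add[OF assms(1)] assms(2) by (intro nth_equalityI) simp_all
  then have "map s [0..<flen i + r] = word i @ map s [0..<r]"
    using map_s_upt_split[of "flen i" "flen i + r"] by (simp add: map_s_word)
  then show ?thesis by (simp add: block_start_def tau_iter_append tau_iter_word length_word)
qed

lemma block_start_flen: "0 < i \<Longrightarrow> block_start k (flen i) = flen (i + 2 * k)"
  using block_start_flen_add[of i 0 k] by (simp add: block_start_0)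

lemma half_flen: "flen (2 * k + 3) div 2 = flen (2 * k) + mid k"
proof -
  have "flen (2 * k + 3) div 2 = mid (Suc k)" by (simp add: mid_def numeral_3_eq_3)
  then show ?thesis by (simp add: mid_Suc length_wordA)
qed

text \<open>The low digits alone give the point \<open>mid k\<close> inside the first block
  \<open>B\<close>, which has index 1. Each further digit at \<open>J\<close> translates the block
  index by \<open>flen (J - 2 * k)\<close>, and by self-similarity the letter there is still
  0.\<close>

lemma E'_position:
  assumes "x \<in> E' k"
  shows "\<exists>j. \<not> s j \<and> x = block_start k j + mid k"
proof -
  let ?a = "digits x"
  have adm: "admissible ?a" using digits_properties(1)[OF less_flen] .
  have low: "psum ?a (2 * k + 3) = flen (2 * k) + mid k"
    using assms by (simp add: E'_def Phi_eq_psum half_flen)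
  have "\<exists>j. \<not> s j \<and> psum ?a J = block_start k j + mid k" if "2 * k + 3 \<le> J" for J
    using that
  proof (induction J rule: dec_induct)
    case base
    have "\<not> s 1" using wordA_nth[of 1 1] wordA_Suc[of 0] by (simp add: wordA_0 wordB_0)
    moreover have "block_start k 1 = flen (2 * k)"
      using block_start_Suc[of k 0] wordA_nth[of 0 0] by (simp add: block_start_0 wordA_0 length_wordA)
    ultimately show ?case using low by (intro exI[of _ 1]) simp
  next
    case (step J)
    then obtain j where j: "\<not> s j" "psum ?a J = block_start k j + mid k" by blast
    show ?case
    proof (cases "?a J = 0")
      case True
      then show ?thesis using j by (auto simp: psum_Suc)
    next
      case False
      then have aJ: "?a J = 1" using admissible_bit[OF adm, of J] by auto
      define I where "I = J - 2 * k"
      have I: "J = I + 2 * k" "3 \<le> I" using step.hyps by (auto simp: I_def)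
      define I' where "I' = (if odd I then I - 1 else I - 2)"
      have I': "0 < I'" "flen (Suc I) = flen I + flen I'"
        using I flen_diff[of I] by (auto simp: I'_def)
      have "flen (Suc J) = flen J + flen (I' + 2 * k)"
        using flen_diff[of J] I by (auto simp: I'_def)
      moreover have "psum ?a J + flen J < flen (Suc J)"
        using psum_less[OF adm, of "Suc J"] aJ by (simp add: psum_Suc)
      \<comment> \<open>The bound on the partial sums, pulled back through the increasing
        \<open>block_start k\<close>, confines \<open>j\<close> to the range in which
        \<open>s_flen_add\<close> applies.\<close>
      ultimately have "block_start k j < block_start k (flen I')"
        using j(2) block_start_flen[OF I'(1), of k] by simp
      then have less: "j < flen I'" using strict_mono_less[OF block_start_strict_mono] by blast
      have "s (flen I + j) = s j" using s_flen_add[of I j] I I' less by simp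
      moreover have "block_start k (flen I + j) = flen J + block_start k j"
        using block_start_flen_add[of I j k] I I' less by simp
      ultimately show ?thesis using j aJ by (intro exI[of _ "flen I + j"]) (simp add: psum_Suc)
    qed
  qed
  from this[of "2 * k + 3 + x"] obtain j where j: "\<not> s j" "psum ?a (2 * k + 3 + x) = block_start k j + mid k" by auto
  have "x < flen (2 * k + 3 + x)" using less_flen[of "2 * k + 3 + x"] by simp
  then have "psum ?a (2 * k + 3 + x) = x" by (rule digits_properties(3))
  then show ?thesis using j by auto
qed

lemma mid_bound_flen: "flen (2 * k) + mid k < flen (2 * k + 2)"
proof -
  have "flen (2 * k + 2) = 2 * length (wordA k) + length (wordB k)"
    using flen_rec_even[of k] length_AB[of k] by (simp add: length_wordA)
  moreover have "0 < length (wordB k)" using length_wordB_bounds[of k] by blast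
  ultimately show ?thesis using mid_bounds(2)[of k] unfolding length_wordA by linarith
qed

text \<open>A digit 1 far above leaves the digits of \<open>flen (2 * k) + mid k\<close> untouched.
  These lie below \<open>2 * k + 2\<close>, so from index \<open>2 * k + 4\<close> on the new digit
  is admissible in either parity.\<close>

lemma infinite_E': "infinite (E' k)"
proof
  assume "finite (E' k)"
  let ?n = "flen (2 * k) + mid k"
  have "flen I + ?n \<in> E' k" if "2 * k + 4 \<le> I" for I
  proof -
    let ?a = "digits ?n" and ?b = "(digits ?n)(I := 1)"
    note a = digits_properties[OF mid_bound_flen[of k]]
    have b: "admissible ?b"
      by (rule admissible_insert[of _ "2 * k + 2"]) (use a that in auto)
    have b3: "psum ?b (2 * k + 3) = ?n"
    proof -
      have "psum ?b (2 * k + 3) = psum ?a (2 * k + 3)" using that by (intro psum_cong) auto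
      also have "\<dots> = psum ?a (2 * k + 2)" using a(2) by (intro psum_split) auto
      finally show ?thesis using a(3) by simp
    qed
    have "psum ?b I = ?n"
      using psum_split[of "2 * k + 3" I ?b] a(2) b3 that by simp
    then have "digits (flen I + ?n) = ?b"
      using a(2) that by (intro digits_eqI[of _ "Suc I"] b) (auto simp: psum_Suc)
    then show ?thesis using b3 by (simp add: E'_def Phi_eq_psum half_flen)
  qed
  then have "(\<lambda>I. flen I + ?n) ` {2 * k + 4..} \<subseteq> E' k" by auto
  moreover have "inj_on (\<lambda>I. flen I + ?n) {2 * k + 4..}"
    using strict_mono_eq[OF flen_strict_mono] by (auto intro: inj_onI)
  ultimately have "finite {2 * k + 4..}"
    using \<open>finite (E' k)\<close> by (metis finite_imageD finite_subset)
  then show False by (simp add: infinite_Ici)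
qed

lemma gamma_in_E': "gamma k i \<in> E' k"
  unfolding gamma_def by (rule enumerate_in_set[OF infinite_E'])

text \<open>Two zeros of \<open>s\<close> are never adjacent, so at least one block \<open>A\<close>
  separates the corresponding blocks \<open>B\<close>.\<close>

lemma E'_gap:
  assumes "x \<in> E' k" "y \<in> E' k" "x < y"
  shows "x + flen (2 * k) \<le> y"
proof -
  obtain i j where i: "\<not> s i" "x = block_start k i + mid k" and j: "\<not> s j" "y = block_start k j + mid k"
    using E'_position assms(1,2) by meson
  then have "i < j" using assms(3) strict_mono_less[OF block_start_strict_mono, of k i j] by simp
  moreover have si: "s (Suc i)" using s_after_zero[OF i(1)] by simp
  ultimately have "Suc (Suc i) \<le> j" using j(1) by (metis Suc_leI le_neq_implies_less)
  then have "block_start k (Suc (Suc i)) \<le> block_start k j"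
    using strict_mono_less_eq[OF block_start_strict_mono] by blast
  then show ?thesis using i j si block_start_Suc[of k i] block_start_Suc[of k "Suc i"]
    by (simp add: length_wordA)
qed

text \<open>The digits of \<open>x\<close> from \<open>2 * k + 3\<close> on are kept and the lower
  ones replaced by those of \<open>flen (2 * k) + mid k - d\<close>. This number is below
  \<open>flen (2 * k + 2)\<close>, so digit \<open>2 * k + 2\<close> is zero and no constraint is
  violated at the seam: the odd index \<open>2 * k + 1\<close> does not exclude
  \<open>2 * k + 3\<close>.\<close>

lemma Phi_before_E':
  assumes "x \<in> E' k" "d < flen (2 * k)"
  shows "Phi k (x - d) = flen (2 * k) + mid k - d" "d \<le> x"
proof -
  let ?e = "digits x" and ?y = "flen (2 * k) + mid k - d"
  define J where "J = 2 * k + 3 + x"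
  have xJ: "x < flen J" using less_flen[of J] by (simp add: J_def)
  note e = digits_properties[OF xJ]
  have y: "?y < flen (2 * k + 2)" using mid_bound_flen[of k] by simp
  let ?u = "digits ?y"
  note u = digits_properties[OF y]
  define c where "c i = (if i < 2 * k + 3 then ?u i else ?e i)" for i
  have low: "psum ?e (2 * k + 3) = flen (2 * k) + mid k"
    using assms by (simp add: E'_def Phi_eq_psum half_flen)
  have "admissible c"
  proof (rule admissibleI[of _ J])
    fix i
    show "c i = 0 \<or> c i = 1" using admissible_bit[OF u(1)] admissible_bit[OF e(1)] by (simp add: c_def)
    show "c i = 0" if "J \<le> i" using that e(2) by (simp add: c_def J_def)
    show False if "c i = 1" "c (Suc i) = 1"
      using that admissible_next[OF u(1), of i] admissible_next[OF e(1), of i] u(2)[of i]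
      by (cases "Suc i < 2 * k + 3"; cases "i < 2 * k + 3") (auto simp: c_def)
    show False if "even i" "c i = 1" "c (i + 2) = 1"
    proof (cases "i + 2 < 2 * k + 3")
      case True
      then show False using that admissible_next2[OF u(1), of i] by (auto simp: c_def)
    next
      case False
      then have "i \<noteq> 2 * k + 1" "2 * k + 1 \<le> i" using that(1) by auto
      then have "2 * k + 2 \<le> i" by simp
      then show False using that admissible_next2[OF e(1), of i] u(2)[of i]
        by (cases "i < 2 * k + 3") (auto simp: c_def)
    qed
  qed
  have c3: "psum c (2 * k + 3) = ?y"
  proof -
    have "psum c (2 * k + 3) = psum ?u (2 * k + 3)" by (intro psum_cong) (simp add: c_def)
    also have "\<dots> = psum ?u (2 * k + 2)" using u(2) by (intro psum_split) auto
    finally show ?thesis using u(3) by simp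
  qed
  have split: "psum a J = psum a (2 * k + 3) + (\<Sum>i\<in>{2 * k + 3..<J}. a i * flen i)" for a
  proof -
    have "2 * k + 3 \<le> J" by (simp add: J_def)
    then show ?thesis
      using sum.atLeastLessThan_concat[of 0 "2 * k + 3" J "\<lambda>i. a i * flen i"]
      by (simp add: psum_def lessThan_atLeast0)
  qed
  have "(\<Sum>i\<in>{2 * k + 3..<J}. c i * flen i) = (\<Sum>i\<in>{2 * k + 3..<J}. ?e i * flen i)"
    by (intro sum.cong) (auto simp: c_def)
  then have "psum c J + d = x" using split[of c] split[of ?e] c3 low e(3) assms(2) by simp
  then have v: "psum c J = x - d" and "d \<le> x" by auto
  then show "d \<le> x" by simp
  have "digits (x - d) = c"
    by (rule digits_eqI[OF \<open>admissible c\<close> _ v]) (use e(2) in \<open>auto simp: c_def J_def\<close>)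
  then show "Phi k (x - d) = ?y" using c3 by (simp add: Phi_eq_psum)
qed

subsection \<open>Evaluation of the Hankel determinants\<close>

lemma hankel_eq_toeplitz:
  "hankel m n = (-1) ^ (n * (n - 1) div 2) *
     fdet n (\<lambda>i j. of_bool (s (nat (int (m + n) - 1 + int i - int j))))"
proof -
  have "fdet n (\<lambda>i j. of_bool (s (nat (int (m + n) - 1 + int i - int j)))) =
      fdet n (\<lambda>i j. of_bool (s (m + i + (n - 1 - j))))"
  proof (intro fdet_cong arg_cong[where f = of_bool] arg_cong[where f = s])
    fix i j assume "i < n" "j < n"
    then show "nat (int (m + n) - 1 + int i - int j) = m + i + (n - 1 - j)"
      by (simp add: of_nat_diff nat_eq_iff)
  qed
  also have "\<dots> = (-1) ^ (n * (n - 1) div 2) * fdet n (\<lambda>i j. of_bool (s (m + i + j)))"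
    by (rule fdet_reverse_cols)
  finally show ?thesis
    by (simp add: hankel_def fdet_def flip: mult.assoc power_mult_distrib)
qed

lemma toeplitz_window_local_word:
  assumes "q < length (wordA k)" "length (wordB k) \<le> N" "N < length (wordA k) + length (wordB k)"
  shows "toeplitz_window (length (wordA k)) (length (wordB k)) (mid k) q N ((-1) ^ mid k) (periodicA k) (local_word k)"
proof
  show "odd (length (wordA k))" by (rule odd_length_wordA)
  show "0 < length (wordB k)" "length (wordB k) \<le> length (wordA k)" using length_wordB_bounds by auto
  show "length (wordA k) + length (wordB k) = 2 * mid k" by (rule two_mid[symmetric])
  show "coprime (int (length (wordB k))) (int (length (wordA k)))" using coprime_lengths[of k] by simp
  show "(-1) ^ mid k = (1 :: int) \<or> (-1) ^ mid k = (-1 :: int)" by (cases "even (mid k)") auto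
qed (fact assms periodicA_periodic periodicA_shift_diff local_word_left local_word_right local_word_total)+

lemma hankel_at_window:
  assumes j: "\<not> s j" and q: "q < length (wordA k)"
    and n: "length (wordA k) + length (wordB k) \<le> n" "n < 2 * length (wordA k) + length (wordB k)"
    and mn: "m + n + length (wordA k) = block_start k j + mid k + q + 1"
  shows "hankel m n = (-1) ^ (n * (n - 1) div 2) * (((-1) ^ mid k * (-1) ^ q) ^ (n - length (wordA k)) *
    fdet (length (wordA k)) (toeplitz_window.minor (length (wordB k)) (mid k) q (n - length (wordA k)) (periodicA k) (local_word k)))"
proof -
  let ?a = "length (wordA k)" and ?b = "length (wordB k)" and ?h = "mid k"
  define N where "N = n - ?a"
  have N: "?b \<le> N" "N < ?a + ?b" "n = ?a + N" using n by (simp_all add: N_def)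
  interpret toeplitz_window ?a ?b ?h q N "(-1) ^ ?h" "periodicA k" "local_word k"
    by (rule toeplitz_window_local_word[OF q N(1,2)])
  have "fdet n (\<lambda>i j'. of_bool (s (nat (int (m + n) - 1 + int i - int j')))) = fdet n toep"
  proof (intro fdet_cong)
    fix i j' assume ij: "i < n" "j' < n"
    define x where "x = int ?h - int ?a + int q + int i - int j'"
    have x: "int (m + n) - 1 + int i - int j' = int (block_start k j) + x"
      using mn by (simp add: x_def)
    have "of_bool (s (nat (int (block_start k j) + x))) = local_word k x"
    proof (rule s_local[OF j])
      \<comment> \<open>The smallest argument is at least \<open>h - a - (n - 1)\<close>, the
        largest at most \<open>h + n - 2\<close>; \<open>a + b = 2 * h\<close> and
        \<open>n < 2 * a + b\<close> put both inside the range of \<open>s_local\<close>.\<close>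
      show "- int (2 * ?a + ?h) < x" "x < int (?b + 2 * ?a + ?h) - 1"
        using ij n q two_h by (simp_all add: x_def)
      have "0 \<le> int (m + n) - 1 + int i - int j'" using ij by simp
      then show "0 \<le> int (block_start k j) + x" by (simp only: x)
    qed
    then show "of_bool (s (nat (int (m + n) - 1 + int i - int j'))) = toep i j'"
      by (simp only: x x_def)
  qed
  then show ?thesis
    using toeplitz_det_eq_minor by (simp add: hankel_eq_toeplitz[of m n] flip: N_def N(3))
qed

lemma sign_half_even:
  assumes "even (n :: nat)"
  shows "(-1 :: int) ^ (n * (n - 1) div 2) = (-1) ^ (n div 2)"
proof (cases "n = 0")
  case False
  then have "n * (n - 1) div 2 = n div 2 * (n - 1)" using assms by (simp add: div_mult_swap dvd_div_mult)
  moreover have "odd (n - 1)" using assms False by simp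
  ultimately show ?thesis by (simp add: minus_one_power_iff)
qed simp

text \<open>The signs in case (3) are expressed by the distance \<open>e\<close> from the largest
  order \<open>c\<close>; this brings the sign of the column reversal into that form.\<close>

lemma sign_triangle_shift:
  assumes "even (c :: nat)" "e \<le> c"
  shows "(-1 :: int) ^ ((c - e) * (c - e - 1) div 2) = (-1) ^ (c div 2) * (-1) ^ e * (-1) ^ (e * (e - 1) div 2)"
  using assms(2)
proof (induction e)
  case 0
  then show ?case using sign_half_even[OF assms(1)] by simp
next
  case (Suc e)
  have "(c - e) * (c - e - 1) div 2 = (c - Suc e) * (c - Suc e - 1) div 2 + (c - Suc e)"
  proof -
    obtain d where d: "c - e = Suc d" "c - Suc e = d" using Suc.prems by (metis Suc_diff_Suc Suc_le_lessD)
    show ?thesis unfolding d by (cases d) (simp_all add: algebra_simps)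
  qed
  then have 1: "(-1 :: int) ^ ((c - e) * (c - e - 1) div 2) =
      (-1) ^ ((c - Suc e) * (c - Suc e - 1) div 2) * (-1) ^ (c - Suc e)"
    by (simp add: power_add)
  have "Suc e * (Suc e - 1) div 2 = e * (e - 1) div 2 + e"
    by (cases e) (simp_all add: algebra_simps)
  then have 2: "(-1 :: int) ^ (Suc e * (Suc e - 1) div 2) = (-1) ^ (e * (e - 1) div 2) * (-1) ^ e"
    by (simp add: power_add)
  have 3: "(-1 :: int) ^ (c - Suc e) = (-1) ^ Suc e"
    using assms(1) Suc.prems by (auto simp: minus_one_power_iff)
  have 4: "(-1 :: int) ^ Suc e * (-1) ^ Suc e = 1" by (simp flip: power_mult_distrib)
  have IH: "(-1 :: int) ^ ((c - e) * (c - e - 1) div 2) = (-1) ^ (c div 2) * (-1) ^ e * (-1) ^ (e * (e - 1) div 2)"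
    using Suc by simp
  have "(-1 :: int) ^ ((c - Suc e) * (c - Suc e - 1) div 2) =
      (-1) ^ ((c - Suc e) * (c - Suc e - 1) div 2) * ((-1) ^ Suc e * (-1) ^ Suc e)"
    by (simp only: 4 mult_1_right)
  also have "\<dots> = (-1) ^ ((c - e) * (c - e - 1) div 2) * (-1) ^ Suc e"
    by (simp only: 1 3 mult.assoc)
  also have "\<dots> = (-1) ^ (c div 2) * (-1) ^ Suc e * (-1) ^ (Suc e * (Suc e - 1) div 2)"
    by (simp only: IH 2 mult_ac)
  finally show ?case .
qed

lemma hankel_values:
  assumes j: "\<not> s j" and q: "q < flen (2 * k)"
    and n: "flen (2 * k + 1) \<le> n" "n < flen (2 * k + 2)"
    and mn: "m + n + flen (2 * k) = block_start k j + mid k + q + 1"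
  shows "n = flen (2 * k + 2) - 1 \<Longrightarrow>
      hankel m n = (-1) ^ ((flen (2 * k) - 1) div 2) * int (flen (2 * k))"
    and "n = flen (2 * k + 1) \<Longrightarrow> hankel m n = (-1) ^ q * int (flen (2 * k))"
    and "flen (2 * k + 1) < n \<Longrightarrow> n < flen (2 * k + 2) - 1 \<Longrightarrow> hankel m n =
      (if q = 0 \<or> q = flen (2 * k) - 1 then (-1) ^ ((flen (2 * k + 2) - 1 - n) * k)
          * (-1) ^ ((flen (2 * k + 2) - 1 - n) * (flen (2 * k + 2) - 2 - n) div 2)
          * (-1) ^ ((flen (2 * k) - 1) div 2) * int (flen (2 * k)) else 0)"
proof -
  define a b h N where "a = length (wordA k)" and "b = length (wordB k)" and "h = mid k" and "N = n - a"
  have fl: "flen (2 * k) = a" "flen (2 * k + 1) = a + b" "flen (2 * k + 2) = 2 * a + b"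
    using length_AB[of k] flen_rec_even[of k] by (simp_all add: length_wordA a_def b_def)
  have N: "b \<le> N" "N < a + b" "n = a + N" using n fl by (simp_all add: N_def)
  have qa: "q < length (wordA k)" using q fl by (simp add: a_def)
  interpret toeplitz_window a b h q N "(-1) ^ h" "periodicA k" "local_word k"
    unfolding a_def b_def h_def by (rule toeplitz_window_local_word) (use qa N in \<open>simp_all add: a_def b_def\<close>)
  have hank: "hankel m n = (-1) ^ (n * (n - 1) div 2) * (((-1) ^ h * (-1) ^ q) ^ N * fdet a minor)"
    using hankel_at_window[OF j qa, of n m] n mn fl by (simp add: a_def b_def h_def N_def)
  obtain r where a: "a = 2 * r + 1" using odd_a by (elim oddE)
  have b: "b = 2 * h - a" "odd b" using two_h odd_a by presburger+
  \<comment> \<open>The largest order in a cell. From \<open>2 * a + b = a + 2 * h\<close> and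
    \<open>a = 2 * r + 1\<close> follows \<open>c = 2 * (h + r)\<close>; the part \<open>h\<close>
    of the exponent is cancelled by the powers of \<open>\<epsilon>\<close>, and \<open>r\<close>
    remains in the answer.\<close>
  define c where "c = 2 * a + b - 1"
  have "2 * a + b = 2 * (h + r) + 1"
    using two_h a by (simp add: mult_2)
  then have "c = 2 * (h + r)" by (simp add: c_def)
  then have c: "even c" "c div 2 = h + r" by simp_all
  have nc: "n \<le> c" using n fl by (simp add: c_def)
  have h_parity: "(-1 :: int) ^ h = (-1) ^ Suc k" using even_mid[of k] by (simp add: h_def minus_one_power_iff)
  have square: "((-1 :: int) ^ x) * (-1) ^ x = 1" for x :: nat by (simp flip: power_mult_distrib)
  {
    assume "n = flen (2 * k + 2) - 1"
    then have "n = c" and N_max: "N = a + b - 1" using fl N by (simp_all add: c_def)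
    then have "odd N" using odd_a b(2) a_pos by simp
    then have pow: "((-1 :: int) ^ h * (-1) ^ q) ^ N = (-1) ^ h * (-1) ^ q"
      by (cases "even h"; cases "even q") simp_all
    have "hankel m n = (-1) ^ (h + r) * ((-1) ^ h * (-1) ^ q * ((-1) ^ q * int a))"
      unfolding hank pow fdet_minor_maximal[OF N_max]
      unfolding \<open>n = c\<close> sign_half_even[OF c(1)] c(2) ..
    also have "\<dots> = (-1) ^ r * (((-1) ^ h * (-1) ^ h) * ((-1) ^ q * (-1) ^ q)) * int a"
      by (simp only: power_add mult_ac)
    finally show "hankel m n = (-1) ^ ((flen (2 * k) - 1) div 2) * int (flen (2 * k))"
      unfolding fl square using a by simp
  }
  {
    assume "n = flen (2 * k + 1)"
    then have n: "n = 2 * h" and N_min: "N = b" using fl N two_h by simp_all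
    then have pow: "((-1 :: int) ^ h * (-1) ^ q) ^ N = (-1) ^ h * (-1) ^ q"
      using b(2) by (cases "even h"; cases "even q") simp_all
    have minor: "fdet a minor = int a" by (rule fdet_minor_extremal) (simp add: N_min)
    have "hankel m n = (-1) ^ h * ((-1) ^ h * (-1) ^ q * int a)"
      unfolding hank pow minor using sign_half_even[of n] n by simp
    also have "\<dots> = (((-1) ^ h) * (-1) ^ h) * ((-1) ^ q * int a)" by (simp only: mult_ac)
    finally show "hankel m n = (-1) ^ q * int (flen (2 * k))"
      unfolding fl square by simp
  }
  {
    assume range: "flen (2 * k + 1) < n" "n < flen (2 * k + 2) - 1"
    show "hankel m n =
      (if q = 0 \<or> q = flen (2 * k) - 1 then (-1) ^ ((flen (2 * k + 2) - 1 - n) * k)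
          * (-1) ^ ((flen (2 * k + 2) - 1 - n) * (flen (2 * k + 2) - 2 - n) div 2)
          * (-1) ^ ((flen (2 * k) - 1) div 2) * int (flen (2 * k)) else 0)"
    proof (cases "q = 0 \<or> q = a - 1")
      case True
      define e where "e = c - n"
      have e: "flen (2 * k + 2) - 1 - n = e" "flen (2 * k + 2) - 2 - n = e - 1" "e \<le> c" "n = c - e"
        using fl nc by (simp_all add: e_def c_def)
      have minor: "fdet a minor = int a" by (rule fdet_minor_extremal) (use True in blast)
      have "even q" using True odd_a by auto
      have "N + e = 2 * h - 1" using N c_def e b(1) two_h nc by linarith
      then have "even N \<longleftrightarrow> odd e" using two_h a_pos by presburger
      \<comment> \<open>\<open>N\<close> and \<open>e\<close> have opposite parity, \<open>h\<close>
        has the parity of \<open>k + 1\<close>, and \<open>q\<close> is even because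
        \<open>a - 1\<close> is.\<close>
      then have pow: "((-1 :: int) ^ h * (-1) ^ q) ^ N = (-1) ^ (Suc k * Suc e)"
        using \<open>even q\<close> unfolding h_parity by (cases "even k"; cases "even e") simp_all
      have "hankel m n = (-1) ^ (h + r) * (-1) ^ e * (-1) ^ (e * (e - 1) div 2) * ((-1) ^ (Suc k * Suc e) * int a)"
        unfolding hank pow minor unfolding e(4) sign_triangle_shift[OF c(1) e(3)] c(2) ..
      also have "\<dots> = ((-1) ^ Suc k * (-1) ^ e * (-1) ^ (Suc k * Suc e)) * (-1) ^ (e * (e - 1) div 2) * (-1) ^ r * int a"
        by (simp only: power_add h_parity mult_ac)
      \<comment> \<open>Modulo 2, \<open>(k + 1) + e + (k + 1) * (e + 1)\<close> equals
        \<open>e * k\<close>.\<close>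
      also have "(-1) ^ Suc k * (-1) ^ e * (-1) ^ (Suc k * Suc e) = (-1 :: int) ^ (e * k)"
        by (cases "even k"; cases "even e") simp_all
      also have "r = (a - 1) div 2" using a by simp
      finally show ?thesis unfolding e(1,2) unfolding fl using True by simp
    next
      case False
      have "fdet a minor = 0" by (rule fdet_minor_zero) (use False range fl N q in auto)
      then show ?thesis using False hank fl by simp
    qed
  }
qed

theorem theorem3:
  fixes k m n :: nat
  assumes "(m, n) \<in> T k"
  shows "(n = flen (2*k+2) - 1 \<longrightarrow>
           hankel m n = (-1) ^ ((flen (2*k) - 1) div 2) * int (flen (2*k))) \<and>
         (n = flen (2*k+1) \<longrightarrow>
           (of_int (hankel m n) :: rat) =
             (-1) powi (int (Phi k (m + n)) - int (flen (2*k+1) div 2) - 1) * of_nat (flen (2*k))) \<and>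
         (flen (2*k+1) < n \<and> n < flen (2*k+2) - 1 \<longrightarrow>
           hankel m n =
             (if \<exists>i\<ge>1. int (m + n) = int (gamma k i) - int (flen (2*k)) + 1 \<or> m + n = gamma k i
              then (-1) ^ ((flen (2*k+2) - 1 - n) * k)
                 * (-1) ^ (((flen (2*k+2) - 1 - n) * (flen (2*k+2) - 2 - n)) div 2)
                 * (-1) ^ ((flen (2*k) - 1) div 2) * int (flen (2*k))
              else 0))"
proof -
  obtain i where i: "1 \<le> i" and cell: "flen (2*k+1) \<le> n" "n < flen (2*k+2)"
    "int (gamma k i) - int (flen (2*k)) < int (n + m)" "n + m \<le> gamma k i"
    using assms by (auto simp: T_def T_cell_def)
  obtain j where j: "\<not> s j" "gamma k i = block_start k j + mid k"
    using E'_position[OF gamma_in_E'] by blast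
  \<comment> \<open>The height of \<open>m + n\<close> above the lower end of its cell: 0 at
    \<open>gamma k i - flen (2 * k) + 1\<close> and \<open>flen (2 * k) - 1\<close> at
    \<open>gamma k i\<close>.\<close>
  define q where "q = m + n + flen (2 * k) - gamma k i - 1"
  have q: "q < flen (2 * k)" "m + n + flen (2 * k) = gamma k i + q + 1"
    using cell(3,4) flen_pos[of "2 * k"] unfolding q_def by linarith+
  note vals = hankel_values[OF j(1) q(1) cell(1,2), of m, folded j(2), OF q(2)]
  have Phi: "Phi k (m + n) = mid k + q + 1"
  proof -
    define d where "d = gamma k i - (m + n)"
    have d: "d < flen (2 * k)" "m + n = gamma k i - d" "flen (2 * k) = d + q + 1"
      using cell(4) q by (simp_all add: d_def)
    show ?thesis unfolding d(2) Phi_before_E'(1)[OF gamma_in_E' d(1)] using d(3) by simp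
  qed
  have exponent: "int (Phi k (m + n)) - int (flen (2*k+1) div 2) - 1 = int q"
    unfolding Phi mid_def by simp
  have part2: "n = flen (2*k+1) \<longrightarrow> (of_int (hankel m n) :: rat) =
      (-1) powi (int (Phi k (m + n)) - int (flen (2*k+1) div 2) - 1) * of_nat (flen (2*k))"
    unfolding exponent power_int_of_nat using vals(2) by simp
  have ends: "(\<exists>i\<ge>1. int (m + n) = int (gamma k i) - int (flen (2*k)) + 1 \<or> m + n = gamma k i) \<longleftrightarrow>
      q = 0 \<or> q = flen (2 * k) - 1"
  proof
    assume "\<exists>i\<ge>1. int (m + n) = int (gamma k i) - int (flen (2*k)) + 1 \<or> m + n = gamma k i"
    then obtain i' where i': "int (m + n) = int (gamma k i') - int (flen (2*k)) + 1 \<or> m + n = gamma k i'" by blast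
    \<comment> \<open>Either alternative puts \<open>m + n\<close> into the interval of length
      \<open>flen (2 * k)\<close> that ends at \<open>gamma k i'\<close>, and by
      \<open>E'_gap\<close> such intervals for different elements of \<open>E' k\<close> are
      disjoint.\<close>
    have "gamma k i' = gamma k i"
    proof (rule ccontr)
      assume "gamma k i' \<noteq> gamma k i"
      then consider "gamma k i' < gamma k i" | "gamma k i < gamma k i'" by linarith
      then have "gamma k i' + flen (2 * k) \<le> gamma k i \<or> gamma k i + flen (2 * k) \<le> gamma k i'"
        using E'_gap[OF gamma_in_E' gamma_in_E'] by cases blast+
      then show False using i' q by linarith
    qed
    then show "q = 0 \<or> q = flen (2 * k) - 1" using i' q by linarith
  next
    assume "q = 0 \<or> q = flen (2 * k) - 1"
    then have "int (m + n) = int (gamma k i) - int (flen (2*k)) + 1 \<or> m + n = gamma k i"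
      using q by linarith
    then show "\<exists>i\<ge>1. int (m + n) = int (gamma k i) - int (flen (2*k)) + 1 \<or> m + n = gamma k i"
      using i by blast
  qed
  show ?thesis unfolding ends using vals(1,3) part2 by blast
qed

end
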